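(* Let $\Xi=\{\xi\}$ be a Poisson point process of intensity one on $\mathbb{R}^2$, and suppose that on each realization of $\Xi$ there are given (random) non-negative finite numbers $d(\xi,\xi')=d(\xi',\xi)$, for $\xi,\xi'\in\Xi$, satisfying the triangle inequality $d(\xi,\xi'')\le d(\xi,\xi')+d(\xi',\xi'')$. Suppose that the distribution of the whole structure $\{\xi; d(\xi,\xi')\}$ is invariant under the action of the translation group $(T_{a,b};\ (a,b)\in\mathbb{R}^2)$, and that for each $(a,b)\neq(0,0)$ the action of $T_{a,b}$ is ergodic. Suppose further that for all bounded (measurable) $A,B\subset\mathbb{R}^2$, $$\sup_{z\in\mathbb{R}^2}\ \frac{E\sum_{\xi\in A}\sum_{\xi'\in z+B} d^2(\xi,\xi')}{\max(1,r_z^2)}<\infty .$$ Then there exist constants $\rho(\theta)\ge 0$, $\theta\in[0,2\pi)$, such that for all bounded (measurable) $A,B\subset\mathbb{R}^2$, $$ r_z^{-1}\, E\,S\big(A,\ z+B;\ r_z\,\rho(\theta_z)\big)\to 0\quad\text{as } r_z\to\infty ,$$ and moreover $$\sup_{\theta_2\neq\theta_1}\frac{|\rho(\theta_2)-\rho(\theta_1)|}{|\theta_2-\theta_1|}<\infty .$$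
   Context: For $(a,b)\in\mathbb{R}^2$, $T_{a,b}$ is the translation $T_{a,b}(x,y)=(x+a,y+b)$ of $\mathbb{R}^2$; it acts on structures $\{\xi; d(\xi,\xi')\}$ by translating the points and carrying the numbers $d(\xi,\xi')$ along with them. For $z\in\mathbb{R}^2$, $(r_z,\theta_z)$ are the polar coordinates of $z$ (with $\theta_z\in[0,2\pi)$), and $z+B=\{z+z':\ z'\in B\}$. Sums $\sum_{\xi\in A}$ are over the points $\xi\in\Xi\cap A$. For bounded $A,B\subset\mathbb{R}^2$ and $c\ge 0$, $$S(A,B;c):=\sum_{\xi\in A}\sum_{\xi'\in B}|d(\xi,\xi')-c| .$$ The limit "as $r_z\to\infty$" is over all $z\in\mathbb{R}^2$ with $r_z\to\infty$, with no restriction on the angle $\theta_z$. The numbers $d(\xi,\xi')$ may depend on the entire configuration $\Xi$ and on additional randomness; no rotational invariance, no locality, and no inequality $d(\xi,\xi')\ge|\xi-\xi'|$ is assumed. *)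

theory Defs
  imports "HOL-Probability.Probability"
begin

type_synonym plane = "real \<times> real"

text \<open>A structure is a pair \<open>(X, d)\<close> of a set of points of the plane and a function whose values
  matter only on \<open>X \<times> X\<close>: the sigma-algebra below does not see the values of \<open>d\<close> elsewhere.\<close>

type_synonym config = "plane set \<times> (plane \<Rightarrow> plane \<Rightarrow> real)"

definition locally_finite :: "plane set \<Rightarrow> bool" where
  "locally_finite X \<longleftrightarrow> (\<forall>A. bounded A \<longrightarrow> finite (X \<inter> A))"

definition configs :: "config set" where
  "configs = {(X, d). locally_finite X}"

definition pair_count :: "plane set \<Rightarrow> plane set \<Rightarrow> real set \<Rightarrow> config \<Rightarrow> nat" where
  "pair_count A B C = (\<lambda>(X, d). card {(\<xi>, \<xi>'). \<xi> \<in> X \<inter> A \<and> \<xi>' \<in> X \<inter> B \<and> d \<xi> \<xi>' \<in> C})"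

text \<open>A structure is identified with the configuration of all triples
  \<open>(\<xi>, \<xi>', d \<xi> \<xi>')\<close>, and carries the usual sigma-algebra of point processes, the one generated
  by the counting variables. (Taking \<open>A = B\<close> and \<open>C = UNIV\<close> gives the number of points in \<open>A\<close>.)\<close>

definition config_space :: "config measure" where
  "config_space = sigma configs
     {{s \<in> configs. pair_count A B C s = n} | A B C n.
        A \<in> sets borel \<and> bounded A \<and> B \<in> sets borel \<and> bounded B \<and> C \<in> sets borel}"

definition translate :: "plane \<Rightarrow> config \<Rightarrow> config" where
  "translate v = (\<lambda>(X, d). ((+) v ` X, \<lambda>x y. d (x - v) (y - v)))"

definition measure_preserving_map :: "'a measure \<Rightarrow> ('a \<Rightarrow> 'a) \<Rightarrow> bool" where
  "measure_preserving_map N T \<longleftrightarrow> T \<in> measurable N N \<and> distr N N T = N"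

definition ergodic_map :: "'a measure \<Rightarrow> ('a \<Rightarrow> 'a) \<Rightarrow> bool" where
  "ergodic_map N T \<longleftrightarrow> measure_preserving_map N T \<and>
     (\<forall>E \<in> sets N. T -` E \<inter> space N = E \<longrightarrow> measure N E = 0 \<or> measure N E = 1)"

definition unit_poisson_process :: "'w measure \<Rightarrow> ('w \<Rightarrow> plane set) \<Rightarrow> bool" where
  "unit_poisson_process M \<Xi> \<longleftrightarrow>
     (\<forall>\<omega> \<in> space M. locally_finite (\<Xi> \<omega>)) \<and>
     (\<forall>A. A \<in> sets borel \<and> bounded A \<longrightarrow>
        (\<lambda>\<omega>. card (\<Xi> \<omega> \<inter> A)) \<in> measurable M (count_space UNIV) \<and>
        (\<forall>k. measure M {\<omega> \<in> space M. card (\<Xi> \<omega> \<inter> A) = k} =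
               exp (- measure lborel A) * measure lborel A ^ k / fact k)) \<and>
     (\<forall>n (A :: nat \<Rightarrow> plane set).
        (\<forall>i<n. A i \<in> sets borel \<and> bounded (A i)) \<and> disjoint_family_on A {..<n} \<longrightarrow>
        prob_space.indep_vars M (\<lambda>_. count_space UNIV) (\<lambda>i \<omega>. card (\<Xi> \<omega> \<inter> A i)) {..<n})"

text \<open>The norm of \<^typ>\<open>real \<times> real\<close> is the Euclidean one, so it is the polar radius.
  \<^const>\<open>Arg2pi\<close> takes values in \<open>[0, 2\<pi>)\<close>.\<close>

definition polar_angle :: "plane \<Rightarrow> real" where
  "polar_angle z = Arg2pi (Complex (fst z) (snd z))"

definition deviation_sum ::
  "plane set \<Rightarrow> (plane \<Rightarrow> plane \<Rightarrow> real) \<Rightarrow> plane set \<Rightarrow> plane set \<Rightarrow> real \<Rightarrow> real" where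
  "deviation_sum X d A B c = (\<Sum>\<xi> \<in> X \<inter> A. \<Sum>\<xi>' \<in> X \<inter> B. \<bar>d \<xi> \<xi>' - c\<bar>)"

lemma space_config_space [simp]: "space config_space = configs"
  unfolding config_space_def by (rule space_measure_of) auto

lemma translate_in_configs:
  assumes "s \<in> configs"
  shows "translate v s \<in> configs"
proof -
  obtain X d where s: "s = (X, d)" by force
  have "finite ((+) v ` X \<inter> A)" if "bounded A" for A
  proof -
    have "(+) v ` X \<inter> A \<subseteq> (+) v ` (X \<inter> (+) (- v) ` A)"
      by (force simp: image_iff)
    moreover have "bounded ((+) (- v) ` A)"
      using that by (rule bounded_translation)
    then have "finite (X \<inter> (+) (- v) ` A)"
      using assms unfolding s configs_def locally_finite_def by blast
    ultimately show ?thesis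
      by (meson finite_imageI finite_subset)
  qed
  then show ?thesis
    by (simp add: s configs_def translate_def locally_finite_def)
qed

lemma pair_count_translate:
  "pair_count A B C (translate v s) = pair_count ((+) (- v) ` A) ((+) (- v) ` B) C s"
proof -
  obtain X d where s: "s = (X, d)" by force
  have "bij_betw (\<lambda>(x, y). (v + x, v + y))
     {(\<xi>, \<xi>'). \<xi> \<in> X \<inter> (+) (- v) ` A \<and> \<xi>' \<in> X \<inter> (+) (- v) ` B \<and> d \<xi> \<xi>' \<in> C}
     {(\<xi>, \<xi>'). \<xi> \<in> (+) v ` X \<inter> A \<and> \<xi>' \<in> (+) v ` X \<inter> B \<and> d (\<xi> - v) (\<xi>' - v) \<in> C}"
    by (rule bij_betwI[where g = "\<lambda>(x, y). (x - v, y - v)"]) (auto simp: image_iff)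
  then show ?thesis
    by (simp add: s pair_count_def translate_def bij_betw_same_card)
qed

lemma measurable_translate: "translate v \<in> measurable config_space config_space"
proof -
  have "translate v -` {s \<in> configs. pair_count A B C s = n} \<inter> configs \<in> sets config_space"
    if "A \<in> sets borel" "bounded A" "B \<in> sets borel" "bounded B" "C \<in> sets borel" for A B C n
  proof -
    have borel: "(+) (- v) ` D \<in> sets borel" if "D \<in> sets borel" for D :: "plane set"
    proof -
      have "(+) (- v) ` D = (+) v -` D \<inter> space borel"
      proof (intro set_eqI iffI)
        fix x assume "x \<in> (+) v -` D \<inter> space borel"
        then show "x \<in> (+) (- v) ` D"
          by (intro image_eqI[where x = "v + x"]) auto
      qed auto
      moreover have "(+) v \<in> measurable borel borel" by simp
      ultimately show ?thesis using that by (metis measurable_sets)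
    qed
    have "translate v -` {s \<in> configs. pair_count A B C s = n} \<inter> configs =
        {s \<in> configs. pair_count ((+) (- v) ` A) ((+) (- v) ` B) C s = n}"
      by (auto simp: pair_count_translate translate_in_configs)
    also have "\<dots> \<in> sets config_space"
      unfolding config_space_def
    proof (rule in_measure_of, blast)
      have "bounded ((+) (- v) ` A)" "bounded ((+) (- v) ` B)"
        using that by (blast intro: bounded_translation)+
      then show "{s \<in> configs. pair_count ((+) (- v) ` A) ((+) (- v) ` B) C s = n} \<in>
          {{s \<in> configs. pair_count A B C s = n} | A B C n.
            A \<in> sets borel \<and> bounded A \<and> B \<in> sets borel \<and> bounded B \<and> C \<in> sets borel}"
        using borel[OF that(1)] borel[OF that(3)] that(5) by blast
    qed
    finally show ?thesis .
  qed
  then show ?thesis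
    by (subst (2) config_space_def, intro measurable_measure_of)
      (auto simp: translate_in_configs)
qed

end

(* Attach to each location x the first nonempty cell to its right, and let D x y be the largest
   distance between points of the cells of x and y. As every nonempty cell serves as a common
   intermediate stop, D satisfies the triangle inequality; the second moment hypothesis together with
   exponential tails for the search gives E D(x, y) <= C max(1, |y - x|). Hence gamma(z) = E D(0, z)
   is subadditive, its rate rho(u) = inf gamma(t u) / t is Lipschitz, and along a fixed ray
   L1-convergence follows from an upper bound alone, since E D(0, m v) >= m t rho(u) for v = t u:
   that bound comes from the chain D(j v, (j + 1) v) and the ergodic theorem for truncations.
   The linear bound on gamma and compactness of the circle make the convergence uniform in the angle.
   Finally d and D differ by two random variables of fixed law, and AM-GM with the
   second moments controls the sums on the event of small probability where the approximation fails. *)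

theory Submission
  imports Defs
begin

section \<open>An ergodic upper bound\<close>

text \<open>The distances live on random points, whereas subadditivity and the ergodic theorem want
  quantities indexed by deterministic locations. A maximum over the points of a cell avoids a
  measurable choice of one point and is visible to a sigma-algebra generated by counts. Since
  \<open>d\<close> may depend on the whole configuration, distances cannot be decoupled from the
  search for occupied cells by independence. Each mean over a rare event is instead split by AM-GM
  with a free scale: a second moment with a small factor, plus the probability of the event with a
  large one. The exponential weights in the first moment bound and the powers of
  \<open>\<eta>\<close> in the final estimate come from tuning this scale. Truncation supplies the
  boundedness on which the ergodic argument rests: a bounded function changes its orbit sums only
  boundedly under one shift, so an unbounded excess is an invariant event. Ergodicity of each single
  translation then makes the limit along a ray constant. Around each of finitely many rays, a cone
  of small aperture is controlled at a cost proportional to that aperture.\<close>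

definition orbit_sum :: "('a \<Rightarrow> 'a) \<Rightarrow> ('a \<Rightarrow> real) \<Rightarrow> nat \<Rightarrow> 'a \<Rightarrow> real" where
  "orbit_sum T f n x = (\<Sum>i<n. f ((T ^^ i) x))"

lemma orbit_sum_0 [simp]: "orbit_sum T f 0 x = 0"
  by (simp add: orbit_sum_def)

lemma orbit_sum_add:
  "orbit_sum T f (m + n) x = orbit_sum T f m x + orbit_sum T f n ((T ^^ m) x)"
proof (induction n)
  case (Suc n)
  have "(T ^^ n) ((T ^^ m) x) = (T ^^ (m + n)) x"
    by (metis add.commute comp_apply funpow_add)
  then show ?case using Suc by (simp add: orbit_sum_def)
qed simp

lemma orbit_sum_Suc: "orbit_sum T f (Suc n) x = f x + orbit_sum T f n (T x)"
  using orbit_sum_add[of T f 1 n x] by (simp add: orbit_sum_def)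

context prob_space
begin

lemma measurable_iterate:
  assumes "measure_preserving_map M T"
  shows "T ^^ n \<in> measurable M M" "distr M M (T ^^ n) = M"
proof -
  have T: "T \<in> measurable M M" "distr M M T = M"
    using assms by (auto simp: measure_preserving_map_def)
  have "T ^^ n \<in> measurable M M \<and> distr M M (T ^^ n) = M"
  proof (induction n)
    case 0
    then show ?case by (simp add: distr_id2 id_def)
  next
    case (Suc n)
    have "distr (distr M M (T ^^ n)) M T = distr M M (T \<circ> (T ^^ n))"
      using T Suc by (intro distr_distr) auto
    then show ?case using T Suc by (metis funpow.simps(2) measurable_comp)
  qed
  then show "T ^^ n \<in> measurable M M" "distr M M (T ^^ n) = M" by auto
qed

lemma expectation_iterate:
  fixes f :: "'a \<Rightarrow> real"
  assumes "measure_preserving_map M T" "f \<in> borel_measurable M"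
  shows "expectation (\<lambda>x. f ((T ^^ n) x)) = expectation f"
  using integral_distr[of "T ^^ n" M M f] measurable_iterate[OF assms(1)] assms(2) by simp

text \<open>The Katznelson--Weiss argument: on the invariant set where \<open>S\<^sub>n f - n c\<close> is unbounded,
  orbits can be cut into blocks of bounded length with averages above \<open>c\<close>, so \<open>c\<close> cannot exceed
  the mean.\<close>

lemma ergodic_upper_bound:
  fixes f :: "'a \<Rightarrow> real"
  assumes erg: "ergodic_map M T" and f [measurable]: "f \<in> borel_measurable M"
    and bnd: "\<And>x. x \<in> space M \<Longrightarrow> 0 \<le> f x \<and> f x \<le> b" and e: "e > 0"
  shows "(\<lambda>n. prob {x \<in> space M. orbit_sum T f n x > real n * (expectation f + e)}) \<longlonglongrightarrow> 0"
proof -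
  have mp: "measure_preserving_map M T" and T [measurable]: "T \<in> measurable M M"
    using erg by (auto simp: ergodic_map_def measure_preserving_map_def)
  note it [measurable] = measurable_iterate(1)[OF mp]
  have Tsp: "T x \<in> space M" if "x \<in> space M" for x
    using that T by (rule measurable_space[rotated])
  have itsp: "(T ^^ n) x \<in> space M" if "x \<in> space M" for x n
    using that it by (rule measurable_space[rotated])
  \<comment> \<open>One half of \<open>e\<close> separates \<open>c\<close> from the mean and yields
    the contradiction below; the other half turns the event of the claim into an excess over
    \<open>n * c\<close> that grows like \<open>n * e / 2\<close>.\<close>
  define c where "c = expectation f + e / 2"
  have intf: "integrable M f"
    using bnd by (intro integrable_const_bound[where B = "\<bar>b\<bar>"]) (auto intro!: AE_I2, fastforce)
  have Ef: "0 \<le> expectation f" using bnd by (intro integral_nonneg_AE) auto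
  then have c: "c > 0" using e by (simp add: c_def)
  have S [measurable]: "orbit_sum T f n \<in> borel_measurable M" for n
    unfolding orbit_sum_def by measurable
  define E where "E = {x \<in> space M. \<forall>B::nat. \<exists>n. orbit_sum T f n x - n * c > real B}"
  have [measurable]: "E \<in> sets M" unfolding E_def by measurable
  \<comment> \<open>The sums at \<open>x\<close> and \<open>T x\<close> differ in two terms only,
    both in \<open>[0, b]\<close>, so an unbounded excess survives the shift in either
    direction.\<close>
  have shift: "\<bar>orbit_sum T f n (T x) - orbit_sum T f n x\<bar> \<le> b" if "x \<in> space M" for n x
  proof -
    have "orbit_sum T f n (T x) - orbit_sum T f n x = f ((T ^^ n) x) - f x"
      using orbit_sum_Suc[of T f n x] orbit_sum_add[of T f n 1 x] by (simp add: orbit_sum_def)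
    then show ?thesis using bnd[OF that] bnd[OF itsp[OF that, of n]] by linarith
  qed
  have "x \<in> E \<longleftrightarrow> T x \<in> E" if x: "x \<in> space M" for x
  proof -
    have *: "\<exists>n. orbit_sum T f n y - n * c > real B"
      if y: "\<forall>B::nat. \<exists>n. orbit_sum T f n z - n * c > real B"
        "\<And>n. \<bar>orbit_sum T f n y - orbit_sum T f n z\<bar> \<le> b" for B y z
    proof -
      obtain n where "orbit_sum T f n z - n * c > real (B + nat \<lceil>b\<rceil>)" using y(1) by blast
      moreover have "real (B + nat \<lceil>b\<rceil>) \<ge> B + b" by linarith
      ultimately show ?thesis using y(2)[of n] by (intro exI[of _ n]) linarith
    qed
    show ?thesis
      using *[of x "T x"] *[of "T x" x] shift[OF x] x Tsp[OF x]
      by (auto simp: E_def abs_minus_commute)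
  qed
  then have inv: "T -` E \<inter> space M = E" by (auto simp: E_def)
  have "prob E \<noteq> 1"
  proof
    assume E1: "prob E = 1"
    \<comment> \<open>Points that start a block of length at most \<open>N\<close> with average
      above \<open>c\<close>. At all other points \<open>g\<close> is raised to at least
      \<open>c\<close>, so that they form blocks of length one.\<close>
    define G where "G N = {x \<in> space M. \<exists>n\<in>{1..N}. orbit_sum T f n x > n * c}" for N :: nat
    have [measurable]: "G N \<in> sets M" for N unfolding G_def by measurable
    have bound: "c \<le> expectation f + c * prob (space M - G N)" for N
    proof -
      define g where "g x = f x + c * indicator (space M - G N) x" for x
      have [measurable]: "g \<in> borel_measurable M" unfolding g_def by measurable
      have g0: "0 \<le> g x" "f x \<le> g x" if "x \<in> space M" for x
        using bnd[OF that] c by (auto simp: g_def)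
      have ind: "integrable M (indicat_real (space M - G N))"
        by (intro integrable_real_indicator) (auto simp: emeasure_eq_measure)
      have intg: "integrable M g" unfolding g_def using intf ind by simp
      have Eg: "expectation g = expectation f + c * prob (space M - G N)"
        unfolding g_def using intf ind by simp
      \<comment> \<open>The orbit is cut greedily from the left. Only the last \<open>N\<close>
        positions may fail to complete a block, and there it is enough that \<open>g\<close> is
        nonnegative.\<close>
      have low: "orbit_sum T g L x \<ge> (real L - N) * c" if "x \<in> space M" for L x
        using that
      proof (induction L arbitrary: x rule: less_induct)
        case (less L)
        have nn: "orbit_sum T g n y \<ge> 0" if "y \<in> space M" for n y
          unfolding orbit_sum_def using itsp[OF that] g0 by (intro sum_nonneg) auto
        show ?case
        proof (cases "L \<le> N")
          case True
          then have "(real L - N) * c \<le> 0" using c by (simp add: mult_nonpos_nonneg)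
          then show ?thesis using nn[OF less.prems, of L] by linarith
        next
          case False
          show ?thesis
          proof (cases "x \<in> G N")
            case True
            then obtain n where n: "n \<ge> 1" "n \<le> N" "orbit_sum T f n x > n * c"
              by (auto simp: G_def)
            have fg: "orbit_sum T f n x \<le> orbit_sum T g n x"
              unfolding orbit_sum_def using itsp[OF less.prems] g0 by (intro sum_mono) auto
            have "orbit_sum T g L x = orbit_sum T g n x + orbit_sum T g (L - n) ((T ^^ n) x)"
              using orbit_sum_add[of T g n "L - n" x] n False by simp
            moreover have "orbit_sum T g (L - n) ((T ^^ n) x) \<ge> (real (L - n) - N) * c"
              using n False itsp[OF less.prems] by (intro less.IH) auto
            moreover have "real (L - n) = real L - n" using n False by simp
            ultimately show ?thesis using n fg by (simp add: algebra_simps)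
          next
            case nG: False
            then have gx: "g x \<ge> c" using bnd[OF less.prems] less.prems by (simp add: g_def)
            obtain K where K: "L = Suc K" using False by (cases L) auto
            have "orbit_sum T g K (T x) \<ge> (real K - N) * c"
              using K Tsp[OF less.prems] by (intro less.IH) auto
            then show ?thesis using gx K by (simp add: orbit_sum_Suc algebra_simps)
          qed
        qed
      qed
      have "(real L - N) * c \<le> real L * expectation g" for L
      proof -
        have integ: "integrable M (\<lambda>x. g ((T ^^ i) x))" for i
          using integrable_distr[of "T ^^ i" M M g] measurable_iterate[OF mp] intg by simp
        have "(real L - N) * c = expectation (\<lambda>x. (real L - N) * c)" by (simp add: prob_space)
        also have "\<dots> \<le> expectation (\<lambda>x. orbit_sum T g L x)"
          unfolding orbit_sum_def using integ low unfolding orbit_sum_def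
          by (intro integral_mono_AE) (auto intro!: Bochner_Integration.integrable_sum)
        also have "\<dots> = real L * expectation g"
          unfolding orbit_sum_def using integ
          by (subst Bochner_Integration.integral_sum) (auto simp: expectation_iterate[OF mp])
        finally show ?thesis .
      qed
      \<comment> \<open>The boundary loss on the right does not grow with \<open>L\<close>, so the
        factor of \<open>L\<close> on the left cannot be positive.\<close>
      then have key: "real L * (c - expectation g) \<le> N * c" for L
        by (simp add: algebra_simps)
      have "c - expectation g \<le> 0"
      proof (rule ccontr)
        assume "\<not> ?thesis"
        then obtain L :: nat where "L * (c - expectation g) > N * c"
          using reals_Archimedean3[of "c - expectation g"] by force
        then show False using key[of L] by simp
      qed
      then show ?thesis using Eg by simp
    qed
    have "E \<subseteq> (\<Union>N. G N)"
    proof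
      fix x assume "x \<in> E"
      then obtain n where n: "orbit_sum T f n x - n * c > 0" "x \<in> space M"
        unfolding E_def by (force dest: spec[of _ 0])
      then have "n \<noteq> 0" by (intro notI) simp
      then show "x \<in> (\<Union>N. G N)" using n by (auto simp: G_def intro!: exI[of _ n] bexI[of _ n])
    qed
    then have "prob (\<Union>N. G N) = 1"
      using E1 finite_measure_mono[of E "\<Union>N. G N"] by (intro antisym) simp_all
    moreover have "(\<lambda>N. prob (G N)) \<longlonglongrightarrow> prob (\<Union>N. G N)"
      by (rule finite_Lim_measure_incseq) (auto simp: incseq_def G_def)
    ultimately have "(\<lambda>N. prob (G N)) \<longlonglongrightarrow> 1" by simp
    then have "(\<lambda>N. expectation f + c * (1 - prob (G N))) \<longlonglongrightarrow> expectation f + c * (1 - 1)"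
      by (intro tendsto_intros)
    then have "c \<le> expectation f + c * (1 - 1)"
      using bound by (intro tendsto_lowerbound[where F = sequentially]) (auto simp: prob_compl)
    then show False using e by (simp add: c_def)
  qed
  then have E0: "prob E = 0"
    using erg inv \<open>E \<in> sets M\<close> unfolding ergodic_map_def by blast
  \<comment> \<open>The event of the claim lies in \<open>U n\<close> (take \<open>m = n\<close>).
    Letting \<open>m\<close> run freely makes the family decreasing, so its probabilities tend to
    that of its intersection, a subset of \<open>E\<close>.\<close>
  define U where "U n = {x \<in> space M. \<exists>m. orbit_sum T f m x - m * c > real n * (e / 2)}" for n :: nat
  have "{x \<in> space M. \<exists>m. orbit_sum T f m x - m * c > K} \<in> sets M" for K :: real
    by measurable
  then have [measurable]: "U n \<in> sets M" for n unfolding U_def by blast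
  have "(\<lambda>n. prob (U n)) \<longlonglongrightarrow> prob (\<Inter>n. U n)"
  proof (rule finite_Lim_measure_decseq)
    show "decseq U"
    proof (intro decseq_SucI subsetI)
      fix n x assume "x \<in> U (Suc n)"
      moreover have "real n * (e / 2) \<le> real (Suc n) * (e / 2)"
        using e by (intro mult_right_mono) auto
      ultimately show "x \<in> U n" unfolding U_def using le_less_trans by blast
    qed
  qed auto
  moreover have "(\<Inter>n. U n) \<subseteq> E"
  proof
    fix x assume x: "x \<in> (\<Inter>n. U n)"
    have "\<exists>n. orbit_sum T f n x - n * c > real B" for B :: nat
    proof -
      obtain n :: nat where "n * (e / 2) > B"
        using reals_Archimedean3[of "e / 2"] e by auto
      moreover have "x \<in> U n" using x by auto
      ultimately show ?thesis unfolding U_def using less_trans by blast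
    qed
    moreover have "x \<in> space M" using x by (auto simp: U_def)
    ultimately show "x \<in> E" by (simp add: E_def)
  qed
  then have "prob (\<Inter>n. U n) = 0"
    using E0 finite_measure_mono[of "\<Inter>n. U n" E] by (simp add: measure_le_0_iff)
  ultimately have lim: "(\<lambda>n. prob (U n)) \<longlonglongrightarrow> 0" by simp
  show ?thesis
  proof (rule tendsto_sandwich[OF _ _ tendsto_const lim])
    show "\<forall>\<^sub>F n in sequentially. prob {x \<in> space M. orbit_sum T f n x > real n * (expectation f + e)}
        \<le> prob (U n)"
    proof (intro always_eventually allI finite_measure_mono subsetI)
      fix n x assume "x \<in> {x \<in> space M. orbit_sum T f n x > real n * (expectation f + e)}"
      then show "x \<in> U n"
        unfolding U_def by (auto simp: c_def algebra_simps intro!: exI[of _ n])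
    qed auto
  qed auto
qed

end

section \<open>Functionals of configurations\<close>

text \<open>With values in \<open>ennreal\<close> the supremum always exists and is 0 when there is
  no pair.\<close>

definition sup_dist :: "plane set \<Rightarrow> plane set \<Rightarrow> config \<Rightarrow> ennreal" where
  "sup_dist A B = (\<lambda>(X, d). SUP (\<xi>, \<xi>') \<in> (X \<inter> A) \<times> (X \<inter> B). ennreal (d \<xi> \<xi>'))"

text \<open>An integral against counting measure, which makes linearity and monotone convergence in
  \<open>g\<close> available for the measurability proof; at outcomes it is a finite double sum
  (\<open>pair_sum_eq\<close>).\<close>

definition pair_sum :: "(real \<Rightarrow> ennreal) \<Rightarrow> plane set \<Rightarrow> plane set \<Rightarrow> config \<Rightarrow> ennreal" where
  "pair_sum g A B = (\<lambda>(X, d). \<integral>\<^sup>+ (\<xi>, \<xi>'). g (d \<xi> \<xi>') \<partial>count_space ((X \<inter> A) \<times> (X \<inter> B)))"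

definition cell :: "plane \<Rightarrow> nat \<Rightarrow> plane set" where
  "cell x i = (+) (x + (real i, 0)) ` cbox 0 (1, 1)"

text \<open>If every cell is empty, the index is an arbitrary number; this happens with probability 0.\<close>

definition home_index :: "plane \<Rightarrow> config \<Rightarrow> nat" where
  "home_index x s = (LEAST i. pair_count (cell x i) (cell x i) UNIV s \<noteq> 0)"

definition home :: "plane \<Rightarrow> config \<Rightarrow> plane set" where
  "home x s = cell x (home_index x s)"

definition home_dist :: "plane \<Rightarrow> plane \<Rightarrow> config \<Rightarrow> ennreal" where
  "home_dist x y s = sup_dist (home x s) (home y s) s"

text \<open>Controls the error made when distances from points of \<open>A\<close> are replaced by
  distances from the home cell of \<open>x\<close>; see \<open>d_near_D\<close>.\<close>

definition point_dist :: "plane set \<Rightarrow> plane \<Rightarrow> config \<Rightarrow> ennreal" where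
  "point_dist A x s = sup_dist A (home x s) s"

section \<open>Measurability and translation equivariance\<close>

lemma borel_image_plus: "A \<in> sets borel \<Longrightarrow> (+) v ` A \<in> sets borel" for v :: plane
proof -
  assume "A \<in> sets borel"
  then have "(+) (- v) -` A \<inter> space borel \<in> sets borel"
    by (intro measurable_sets[of "(+) (- v)" borel borel]) auto
  moreover have "(+) v ` A = (+) (- v) -` A"
  proof (intro set_eqI iffI)
    fix x assume "x \<in> (+) (- v) -` A"
    then show "x \<in> (+) v ` A" by (intro image_eqI[of _ _ "- v + x"]) auto
  qed auto
  ultimately show ?thesis by simp
qed

lemma borel_cell [measurable, simp]: "cell x i \<in> sets borel"
  unfolding cell_def by (intro borel_image_plus) simp

lemma bounded_cell [simp]: "bounded (cell x i)"
  unfolding cell_def by (intro bounded_translation bounded_cbox)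

lemma plus_cell: "(+) v ` cell x i = cell (v + x) i"
  by (simp add: cell_def image_image add.assoc)

lemma pair_count_measurable:
  assumes "A \<in> sets borel" "bounded A" "B \<in> sets borel" "bounded B" "C \<in> sets borel"
  shows "pair_count A B C \<in> measurable config_space (count_space UNIV)"
  unfolding measurable_count_space_eq2_countable
proof
  show "\<forall>n\<in>UNIV. pair_count A B C -` {n} \<inter> space config_space \<in> sets config_space"
  proof
    fix n
    have "{s \<in> configs. pair_count A B C s = n} \<in> sets config_space"
      unfolding config_space_def using assms by (intro in_measure_of) blast+
    then show "pair_count A B C -` {n} \<inter> space config_space \<in> sets config_space"
      by (simp add: vimage_def Int_def conj_commute)
  qed
qed auto

lemma finite_config_pairs:
  assumes "(X, d) \<in> configs" "bounded A" "bounded B"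
  shows "finite ((X \<inter> A) \<times> (X \<inter> B))"
  using assms by (auto simp: configs_def locally_finite_def)

lemma pair_count_eq_card:
  "pair_count A B C (X, d) = card {p \<in> (X \<inter> A) \<times> (X \<inter> B). d (fst p) (snd p) \<in> C}"
  by (auto simp: pair_count_def intro!: arg_cong[of _ _ card])

lemma pair_count_eq_0_iff:
  assumes "(X, d) \<in> configs" "bounded A" "bounded B"
  shows "pair_count A B C (X, d) = 0 \<longleftrightarrow> (\<forall>\<xi>\<in>X \<inter> A. \<forall>\<xi>'\<in>X \<inter> B. d \<xi> \<xi>' \<notin> C)"
  using finite_config_pairs[OF assms] by (auto simp: pair_count_eq_card)

text \<open>The supremum is at most \<open>y\<close> exactly when no pair has a distance above
  \<open>y\<close>, and a vanishing pair count is one of the generating events.\<close>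

lemma sup_dist_measurable:
  assumes "A \<in> sets borel" "bounded A" "B \<in> sets borel" "bounded B"
  shows "sup_dist A B \<in> borel_measurable config_space"
proof (rule borel_measurableI_le)
  fix y :: ennreal
  have [measurable]: "pair_count A B {x. y < ennreal x} \<in> measurable config_space (count_space UNIV)"
  proof (rule pair_count_measurable)
    have "ennreal -` {y<..} \<inter> space borel \<in> sets borel"
      by (intro measurable_sets[of _ borel borel]) auto
    then show "{x. y < ennreal x} \<in> sets borel" by (simp add: vimage_def)
  qed (use assms in auto)
  have "{s \<in> space config_space. pair_count A B {x. y < ennreal x} s = 0} \<in> sets config_space"
    by measurable
  moreover have "sup_dist A B s \<le> y \<longleftrightarrow> pair_count A B {x. y < ennreal x} s = 0"
    if "s \<in> configs" for s
    using that assms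
    by (cases s) (auto simp: pair_count_eq_0_iff sup_dist_def SUP_le_iff not_less)
  ultimately show "{s \<in> space config_space. sup_dist A B s \<le> y} \<in> sets config_space"
    by (simp cong: conj_cong)
qed

text \<open>For an indicator \<open>g\<close> the sum is a counting variable; the other functions
  follow by the standard induction over nonnegative measurable functions.\<close>

lemma pair_sum_measurable:
  assumes "g \<in> borel_measurable borel"
    "A \<in> sets borel" "bounded A" "B \<in> sets borel" "bounded B"
  shows "pair_sum g A B \<in> borel_measurable config_space"
  using assms(1)
proof (induction g rule: borel_measurable_induct)
  case (cong f g)
  then have "f = g" by auto
  with cong show ?case by simp
next
  case (set C)
  have m: "pair_count A B C \<in> measurable config_space (count_space UNIV)"
    using assms set by (intro pair_count_measurable) auto
  have "pair_sum (indicator C) A B s = of_nat (pair_count A B C s)" if "s \<in> configs" for s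
  proof -
    obtain X d where s: "s = (X, d)" by force
    have "pair_sum (indicator C) A B s =
      (\<integral>\<^sup>+ p. indicator {p \<in> (X \<inter> A) \<times> (X \<inter> B). d (fst p) (snd p) \<in> C} p \<partial>count_space ((X \<inter> A) \<times> (X \<inter> B)))"
      by (auto simp: s pair_sum_def indicator_def intro!: nn_integral_cong)
    also have "\<dots> = emeasure (count_space ((X \<inter> A) \<times> (X \<inter> B)))
        {p \<in> (X \<inter> A) \<times> (X \<inter> B). d (fst p) (snd p) \<in> C}"
      by (rule nn_integral_indicator) auto
    also have "\<dots> = of_nat (pair_count A B C s)"
      using finite_config_pairs[of X d A B] that assms unfolding s pair_count_eq_card
      by (subst emeasure_count_space_finite) auto
    finally show ?thesis .
  qed
  moreover have "(\<lambda>s. of_nat (pair_count A B C s) :: ennreal) \<in> borel_measurable config_space"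
    using m by measurable
  ultimately show ?case
    by (subst measurable_cong) auto
next
  case (mult u c)
  have "pair_sum (\<lambda>x. c * u x) A B s = c * pair_sum u A B s" for s
    unfolding pair_sum_def by (cases s) (simp add: nn_integral_cmult split_beta')
  then show ?case using mult by (simp add: fun_eq_iff cong: measurable_cong)
next
  case (add u v)
  have "pair_sum (\<lambda>x. v x + u x) A B s = pair_sum v A B s + pair_sum u A B s" for s
    unfolding pair_sum_def by (cases s) (simp add: nn_integral_add split_beta')
  then show ?case using add by (simp add: fun_eq_iff cong: measurable_cong)
next
  case (seq U)
  have eq: "pair_sum (SUP i. U i) A B = (\<lambda>s. SUP i. pair_sum (U i) A B s)"
  proof
    fix s :: config
    obtain X d where s: "s = (X, d)" by force
    show "pair_sum (SUP i. U i) A B s = (SUP i. pair_sum (U i) A B s)"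
      unfolding s pair_sum_def case_prod_beta SUP_apply fst_conv snd_conv
      using \<open>incseq U\<close>
      by (intro nn_integral_monotone_convergence_SUP) (auto simp: incseq_def le_fun_def)
  qed
  show ?case unfolding eq using seq by (intro borel_measurable_SUP) auto
qed

lemma home_index_measurable [measurable]:
  "home_index x \<in> measurable config_space (count_space UNIV)"
proof -
  note [measurable] = pair_count_measurable
  show ?thesis unfolding home_index_def by measurable
qed

text \<open>The two random cells range over countable families, so freezing one index at a time
  leaves suprema over fixed sets.\<close>

lemma home_dist_measurable [measurable]: "home_dist x y \<in> borel_measurable config_space"
proof -
  have "(\<lambda>s. sup_dist (cell x i) (home y s) s) \<in> borel_measurable config_space" for i
    unfolding home_def
    by (rule measurable_compose_countable[OF _ home_index_measurable])
      (simp add: sup_dist_measurable)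
  then have "(\<lambda>s. sup_dist (cell x (home_index x s)) (home y s) s) \<in> borel_measurable config_space"
    by (rule measurable_compose_countable[OF _ home_index_measurable])
  then show ?thesis by (simp add: home_dist_def home_def [of x] cong: measurable_cong)
qed

lemma point_dist_measurable:
  assumes "A \<in> sets borel" "bounded A"
  shows "point_dist A x \<in> borel_measurable config_space"
  unfolding point_dist_def home_def
  by (rule measurable_compose_countable[OF _ home_index_measurable])
    (simp add: sup_dist_measurable assms)

lemma sup_dist_translate:
  "sup_dist A B (translate v s) = sup_dist ((+) (- v) ` A) ((+) (- v) ` B) s"
proof -
  obtain X d where s: "s = (X, d)" by force
  have eq: "(+) v ` X \<inter> C = (+) v ` (X \<inter> (+) (- v) ` C)" for C
    by (force simp: image_iff)
  have "((+) v ` X \<inter> A) \<times> ((+) v ` X \<inter> B) =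
      (\<lambda>(x, y). (v + x, v + y)) ` ((X \<inter> (+) (- v) ` A) \<times> (X \<inter> (+) (- v) ` B))"
    unfolding eq by force
  then show ?thesis
    by (simp add: s sup_dist_def translate_def image_image case_prod_beta del: add_uminus_conv_diff)
qed

text \<open>The search sees the configuration only relative to its starting location, hence it
  commutes with translations.\<close>

lemma home_translate: "home_index x (translate v s) = home_index (x - v) s"
  "(+) (- v) ` home x (translate v s) = home (x - v) s"
proof -
  show *: "home_index x (translate v s) = home_index (x - v) s"
    unfolding home_index_def pair_count_translate plus_cell by simp
  show "(+) (- v) ` home x (translate v s) = home (x - v) s"
    unfolding home_def plus_cell * by simp
qed

lemma home_dist_translate: "home_dist x y (translate v s) = home_dist (x - v) (y - v) s"
  unfolding home_dist_def sup_dist_translate home_translate ..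

lemma point_dist_translate:
  "point_dist A x (translate v s) = point_dist ((+) (- v) ` A) (x - v) s"
  unfolding point_dist_def sup_dist_translate home_translate ..

lemma translate_funpow:
  "(translate v ^^ n) s = translate (real n *\<^sub>R v) s"
proof (induction n)
  case 0
  show ?case by (cases s) (simp add: translate_def)
next
  case (Suc n)
  have "translate v (translate w s) = translate (v + w) s" for v w
    by (cases s) (simp add: translate_def image_image add.assoc diff_diff_eq)
  with Suc show ?case by (simp add: scaleR_add_left)
qed

section \<open>Distances between cells\<close>

locale poisson_metric = prob_space M for M :: "'w measure" +
  fixes \<Xi> :: "'w \<Rightarrow> plane set" and d :: "'w \<Rightarrow> plane \<Rightarrow> plane \<Rightarrow> real"
  assumes measurable_structure: "(\<lambda>\<omega>. (\<Xi> \<omega>, d \<omega>)) \<in> measurable M config_space"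
    and poisson: "unit_poisson_process M \<Xi>"
    and nonneg: "\<And>\<omega> \<xi> \<xi>'. \<lbrakk>\<omega> \<in> space M; \<xi> \<in> \<Xi> \<omega>; \<xi>' \<in> \<Xi> \<omega>\<rbrakk> \<Longrightarrow> 0 \<le> d \<omega> \<xi> \<xi>'"
    and symm: "\<And>\<omega> \<xi> \<xi>'. \<lbrakk>\<omega> \<in> space M; \<xi> \<in> \<Xi> \<omega>; \<xi>' \<in> \<Xi> \<omega>\<rbrakk> \<Longrightarrow> d \<omega> \<xi> \<xi>' = d \<omega> \<xi>' \<xi>"
    and triangle: "\<And>\<omega> \<xi> \<xi>' \<xi>''. \<lbrakk>\<omega> \<in> space M; \<xi> \<in> \<Xi> \<omega>; \<xi>' \<in> \<Xi> \<omega>; \<xi>'' \<in> \<Xi> \<omega>\<rbrakk>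
           \<Longrightarrow> d \<omega> \<xi> \<xi>'' \<le> d \<omega> \<xi> \<xi>' + d \<omega> \<xi>' \<xi>''"
    and invariant: "\<And>v. measure_preserving_map
           (distr M config_space (\<lambda>\<omega>. (\<Xi> \<omega>, d \<omega>))) (translate v)"
    and ergodic: "\<And>v. v \<noteq> 0 \<Longrightarrow> ergodic_map
           (distr M config_space (\<lambda>\<omega>. (\<Xi> \<omega>, d \<omega>))) (translate v)"
    and second_moment: "\<And>A B. \<lbrakk>A \<in> sets borel; bounded A; B \<in> sets borel; bounded B\<rbrakk> \<Longrightarrow>
           (SUP z. (\<integral>\<^sup>+ \<omega>. ennreal (\<Sum>\<xi> \<in> \<Xi> \<omega> \<inter> A. \<Sum>\<xi>' \<in> \<Xi> \<omega> \<inter> (+) z ` B. (d \<omega> \<xi> \<xi>')\<^sup>2) \<partial>M)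
                    / ennreal (max 1 ((norm z)\<^sup>2))) < \<infinity>"
begin

definition realization :: "'w \<Rightarrow> config" where
  "realization \<omega> = (\<Xi> \<omega>, d \<omega>)"

definition law :: "config measure" where
  "law = distr M config_space realization"

text \<open>At outcomes of \<open>M\<close> the supremum is finite, because bounded cells hold
  finitely many points, so \<open>enn2real\<close> loses nothing (\<open>ennreal_D\<close>).\<close>

definition D :: "plane \<Rightarrow> plane \<Rightarrow> 'w \<Rightarrow> real" where
  "D x y \<omega> = enn2real (home_dist x y (realization \<omega>))"

lemma realization_measurable [measurable]: "realization \<in> measurable M config_space"
  using measurable_structure by (simp add: realization_def[abs_def])

lemma law_measurable: "f \<in> measurable law N \<longleftrightarrow> f \<in> measurable config_space N"
  "g \<in> measurable N' law \<longleftrightarrow> g \<in> measurable N' config_space"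
  "sets law = sets config_space" "space law = configs"
  by (auto simp: law_def intro!: measurable_cong_sets cong: measurable_cong_sets)

lemma law_preserving: "measure_preserving_map law (translate v)"
  and law_ergodic: "v \<noteq> 0 \<Longrightarrow> ergodic_map law (translate v)"
  using invariant ergodic by (simp_all add: law_def realization_def[abs_def])

lemma prob_space_law: "prob_space law"
  unfolding law_def by (rule prob_space_distr) simp

text \<open>Translations act on configurations and not on \<open>M\<close>, so stationarity is
  applied to the law and pulled back to outcomes.\<close>

lemma nn_integral_translate:
  assumes F: "F \<in> borel_measurable config_space"
  shows "(\<integral>\<^sup>+ \<omega>. F (translate v (realization \<omega>)) \<partial>M) = (\<integral>\<^sup>+ \<omega>. F (realization \<omega>) \<partial>M)"
proof -
  have T: "translate v \<in> measurable law law" "distr law law (translate v) = law"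
    using law_preserving by (auto simp: measure_preserving_map_def)
  have [measurable]: "translate v \<in> measurable config_space config_space"
    by (rule measurable_translate)
  have "(\<integral>\<^sup>+ \<omega>. F (realization \<omega>) \<partial>M) = (\<integral>\<^sup>+ s. F s \<partial>law)"
    unfolding law_def using F by (subst nn_integral_distr) auto
  also have "\<dots> = (\<integral>\<^sup>+ s. F s \<partial>distr law law (translate v))"
    using T by simp
  also have "\<dots> = (\<integral>\<^sup>+ s. F (translate v s) \<partial>law)"
    using T F by (subst nn_integral_distr) (auto simp: law_measurable)
  also have "\<dots> = (\<integral>\<^sup>+ \<omega>. F (translate v (realization \<omega>)) \<partial>M)"
    unfolding law_def using F by (subst nn_integral_distr) auto
  finally show ?thesis ..
qed

lemma finite_points: "\<omega> \<in> space M \<Longrightarrow> bounded A \<Longrightarrow> finite (\<Xi> \<omega> \<inter> A)"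
  using poisson by (auto simp: unit_poisson_process_def locally_finite_def)

lemma realization_configs: "\<omega> \<in> space M \<Longrightarrow> realization \<omega> \<in> configs"
  using measurable_space[OF realization_measurable] by simp

lemma sup_dist_ge:
  assumes "\<xi> \<in> \<Xi> \<omega> \<inter> A" "\<xi>' \<in> \<Xi> \<omega> \<inter> B"
  shows "ennreal (d \<omega> \<xi> \<xi>') \<le> sup_dist A B (realization \<omega>)"
  using assms by (auto simp: sup_dist_def realization_def intro!: SUP_upper2[of "(\<xi>, \<xi>')"])

text \<open>Finitely many pairs are involved, so the supremum is a maximum. Having points that
  attain it allows the triangle inequality to be used on single points.\<close>

lemma sup_dist_cases:
  assumes "\<omega> \<in> space M" "bounded A" "bounded B"
  obtains "\<Xi> \<omega> \<inter> A = {} \<or> \<Xi> \<omega> \<inter> B = {}" "sup_dist A B (realization \<omega>) = 0"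
    | \<xi> \<xi>' where "\<xi> \<in> \<Xi> \<omega> \<inter> A" "\<xi>' \<in> \<Xi> \<omega> \<inter> B"
      "sup_dist A B (realization \<omega>) = ennreal (d \<omega> \<xi> \<xi>')"
proof (cases "(\<Xi> \<omega> \<inter> A) \<times> (\<Xi> \<omega> \<inter> B) = {}")
  case True
  then show ?thesis
    by (intro that(1)) (auto simp: sup_dist_def realization_def bot_ennreal)
next
  case False
  define S where "S = (\<lambda>(\<xi>, \<xi>'). ennreal (d \<omega> \<xi> \<xi>')) ` ((\<Xi> \<omega> \<inter> A) \<times> (\<Xi> \<omega> \<inter> B))"
  have fin: "finite S" "S \<noteq> {}"
    using False finite_points assms unfolding S_def by auto
  then have "Sup S \<in> S" using Max_Sup Max_in by metis
  then show ?thesis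
    by (auto simp: sup_dist_def realization_def S_def intro: that(2))
qed

lemma sup_dist_finite:
  assumes "\<omega> \<in> space M" "bounded A" "bounded B"
  shows "sup_dist A B (realization \<omega>) < \<infinity>"
  using assms by (rule sup_dist_cases) auto

lemma pair_sum_eq:
  assumes "\<omega> \<in> space M" "bounded A" "bounded B"
  shows "pair_sum g A B (realization \<omega>) = (\<Sum>\<xi>\<in>\<Xi> \<omega> \<inter> A. \<Sum>\<xi>'\<in>\<Xi> \<omega> \<inter> B. g (d \<omega> \<xi> \<xi>'))"
proof -
  have "finite ((\<Xi> \<omega> \<inter> A) \<times> (\<Xi> \<omega> \<inter> B))" using assms finite_points by auto
  then show ?thesis
    by (simp add: pair_sum_def realization_def nn_integral_count_space_finite
        sum.cartesian_product)
qed

text \<open>The squared maximum is itself one of the summands; this is how the second moment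
  hypothesis reaches distances between cells.\<close>

lemma square_sup_dist_le:
  assumes "\<omega> \<in> space M" "bounded A" "bounded B"
  shows "(sup_dist A B (realization \<omega>))\<^sup>2 \<le> pair_sum (\<lambda>x. ennreal (x\<^sup>2)) A B (realization \<omega>)"
  using assms
proof (cases rule: sup_dist_cases)
  case (2 \<xi> \<xi>')
  have "(sup_dist A B (realization \<omega>))\<^sup>2 = ennreal ((d \<omega> \<xi> \<xi>')\<^sup>2)"
    using 2 nonneg[of \<omega> \<xi> \<xi>'] assms by (simp add: ennreal_power)
  also have "\<dots> \<le> (\<Sum>\<xi>'\<in>\<Xi> \<omega> \<inter> B. ennreal ((d \<omega> \<xi> \<xi>')\<^sup>2))"
    using 2 finite_points assms by (intro member_le_sum) auto
  also have "\<dots> \<le> (\<Sum>\<xi>\<in>\<Xi> \<omega> \<inter> A. \<Sum>\<xi>'\<in>\<Xi> \<omega> \<inter> B. ennreal ((d \<omega> \<xi> \<xi>')\<^sup>2))"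
    using 2 finite_points assms
    by (intro member_le_sum[where f = "\<lambda>\<xi>. \<Sum>\<xi>'\<in>\<Xi> \<omega> \<inter> B. ennreal ((d \<omega> \<xi> \<xi>')\<^sup>2)"]) auto
  finally show ?thesis using pair_sum_eq[OF assms] by simp
qed simp

lemma second_moment_bound:
  assumes "A \<in> sets borel" "bounded A" "B \<in> sets borel" "bounded B"
  obtains K where "K \<ge> 0"
    "\<And>z. (\<integral>\<^sup>+ \<omega>. pair_sum (\<lambda>x. ennreal (x\<^sup>2)) A ((+) z ` B) (realization \<omega>) \<partial>M)
        \<le> ennreal (K * (max 1 (norm z))\<^sup>2)"
proof -
  let ?I = "\<lambda>z. \<integral>\<^sup>+ \<omega>. pair_sum (\<lambda>x. ennreal (x\<^sup>2)) A ((+) z ` B) (realization \<omega>) \<partial>M"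
  have I: "?I z = (\<integral>\<^sup>+ \<omega>. ennreal (\<Sum>\<xi> \<in> \<Xi> \<omega> \<inter> A. \<Sum>\<xi>' \<in> \<Xi> \<omega> \<inter> (+) z ` B. (d \<omega> \<xi> \<xi>')\<^sup>2) \<partial>M)"
    for z
    using assms by (intro nn_integral_cong) (simp add: pair_sum_eq bounded_translation sum_nonneg)
  have m: "max 1 ((norm z)\<^sup>2) = (max 1 (norm z))\<^sup>2" for z :: plane
    by (cases "norm z \<le> 1") (simp_all add: max_absorb1 max_absorb2 power_le_one)
  have "(SUP z. ?I z / ennreal ((max 1 (norm z))\<^sup>2)) < \<infinity>"
    using second_moment[OF assms] by (simp only: I m)
  then obtain K where K: "K \<ge> 0" "(SUP z. ?I z / ennreal ((max 1 (norm z))\<^sup>2)) = ennreal K"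
    by (cases "SUP z. ?I z / ennreal ((max 1 (norm z))\<^sup>2)") auto
  have "?I z \<le> ennreal (K * (max 1 (norm z))\<^sup>2)" for z
  proof -
    have pos: "(max 1 (norm z))\<^sup>2 > 0" by auto
    have "?I z / ennreal ((max 1 (norm z))\<^sup>2) \<le> ennreal K"
      unfolding K(2)[symmetric] by (rule SUP_upper) simp
    then have "?I z / ennreal ((max 1 (norm z))\<^sup>2) * ennreal ((max 1 (norm z))\<^sup>2)
        \<le> ennreal K * ennreal ((max 1 (norm z))\<^sup>2)"
      by (rule mult_right_mono) simp
    moreover have "?I z / ennreal ((max 1 (norm z))\<^sup>2) * ennreal ((max 1 (norm z))\<^sup>2) = ?I z"
      unfolding ennreal_divide_times using pos by (subst ennreal_divide_self) auto
    ultimately show ?thesis using K(1) by (simp add: ennreal_mult)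
  qed
  then show ?thesis using K(1) that by blast
qed

text \<open>Stationarity moves the first square to the origin, so only the difference
  \<open>b - a\<close> matters and one constant serves all pairs of unit squares.\<close>

lemma sup_dist_square_integral:
  obtains K where "K \<ge> 0"
    "\<And>a b. (\<integral>\<^sup>+ \<omega>. (sup_dist ((+) a ` cbox 0 (1, 1)) ((+) b ` cbox 0 (1, 1)) (realization \<omega>))\<^sup>2 \<partial>M)
        \<le> ennreal (K * (max 1 (norm (b - a)))\<^sup>2)"
proof -
  let ?Q = "cbox 0 (1, 1) :: plane set"
  obtain K where K: "K \<ge> 0"
    "\<And>z. (\<integral>\<^sup>+ \<omega>. pair_sum (\<lambda>x. ennreal (x\<^sup>2)) ?Q ((+) z ` ?Q) (realization \<omega>) \<partial>M)
        \<le> ennreal (K * (max 1 (norm z))\<^sup>2)"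
    by (rule second_moment_bound[of ?Q ?Q]) auto
  have "(\<integral>\<^sup>+ \<omega>. (sup_dist ((+) a ` ?Q) ((+) b ` ?Q) (realization \<omega>))\<^sup>2 \<partial>M)
        \<le> ennreal (K * (max 1 (norm (b - a)))\<^sup>2)" for a b
  proof -
    have [measurable]: "sup_dist ((+) a ` ?Q) ((+) b ` ?Q) \<in> borel_measurable config_space"
      by (intro sup_dist_measurable borel_image_plus bounded_translation) auto
    have eq: "sup_dist ((+) a ` ?Q) ((+) b ` ?Q) (translate a s) = sup_dist ?Q ((+) (b - a) ` ?Q) s"
      for s
      unfolding sup_dist_translate image_image by (simp add: add.assoc[symmetric])
    have "(\<integral>\<^sup>+ \<omega>. (sup_dist ((+) a ` ?Q) ((+) b ` ?Q) (realization \<omega>))\<^sup>2 \<partial>M)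
      = (\<integral>\<^sup>+ \<omega>. (sup_dist ((+) a ` ?Q) ((+) b ` ?Q) (translate a (realization \<omega>)))\<^sup>2 \<partial>M)"
      by (rule nn_integral_translate[symmetric]) measurable
    also have "\<dots> = (\<integral>\<^sup>+ \<omega>. (sup_dist ?Q ((+) (b - a) ` ?Q) (realization \<omega>))\<^sup>2 \<partial>M)"
      unfolding eq ..
    also have "\<dots> \<le> (\<integral>\<^sup>+ \<omega>. pair_sum (\<lambda>x. ennreal (x\<^sup>2)) ?Q ((+) (b - a) ` ?Q) (realization \<omega>) \<partial>M)"
      by (intro nn_integral_mono square_sup_dist_le) (auto intro: bounded_translation)
    also note K(2)
    finally show ?thesis .
  qed
  then show ?thesis using K(1) that by blast
qed

section \<open>The search for an occupied cell\<close>

lemma occupied_cell: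
  assumes "\<omega> \<in> space M" "\<Xi> \<omega> \<inter> box x (x + (real n, 1)) \<noteq> {}"
  shows "\<exists>i<n. pair_count (cell x i) (cell x i) UNIV (realization \<omega>) \<noteq> 0"
proof -
  obtain p where p: "p \<in> \<Xi> \<omega>" "p \<in> box x (x + (real n, 1))"
    using assms by auto
  obtain a b x1 x2 where ab: "p = (a, b)" "x = (x1, x2)" by force
  have ineq: "x1 < a" "a < x1 + n" "x2 < b" "b < x2 + 1"
    using p(2) by (auto simp: ab box_def Basis_prod_def)
  \<comment> \<open>The strip is open, so the first coordinate stays strictly below
    \<open>x1 + n\<close> and its floor gives an index strictly below \<open>n\<close>.\<close>
  define i where "i = nat \<lfloor>a - x1\<rfloor>"
  have i: "real i \<le> a - x1" "a - x1 \<le> real i + 1" "i < n"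
    using ineq unfolding i_def by linarith+
  have "p \<in> cell x i"
    unfolding cell_def
  proof
    show "p = x + (real i, 0) + (p - (x + (real i, 0)))" by simp
    show "p - (x + (real i, 0)) \<in> cbox 0 (1, 1)"
      using i ineq by (auto simp: ab cbox_def Basis_prod_def)
  qed
  then have "pair_count (cell x i) (cell x i) UNIV (realization \<omega>) \<noteq> 0"
    using p(1) realization_configs[OF assms(1)]
    unfolding realization_def by (subst pair_count_eq_0_iff) (auto simp del: split_paired_Ex split_paired_All)
  with i show ?thesis by blast
qed

lemma home_index_ge_imp_empty:
  assumes "\<omega> \<in> space M" "n \<le> home_index x (realization \<omega>)"
  shows "\<Xi> \<omega> \<inter> box x (x + (real n, 1)) = {}"
  using occupied_cell[OF assms(1), of x n] assms(2) unfolding home_index_def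
  by (meson leD not_less_Least order_less_le_trans)

lemma prob_card_points:
  assumes "A \<in> sets borel" "bounded A"
  shows "{\<omega> \<in> space M. card (\<Xi> \<omega> \<inter> A) = k} \<in> events"
    and "prob {\<omega> \<in> space M. card (\<Xi> \<omega> \<inter> A) = k}
      = exp (- measure lborel A) * measure lborel A ^ k / fact k"
proof -
  have "(\<lambda>\<omega>. card (\<Xi> \<omega> \<inter> A)) \<in> measurable M (count_space UNIV)"
    using assms poisson by (auto simp: unit_poisson_process_def)
  then show "{\<omega> \<in> space M. card (\<Xi> \<omega> \<inter> A) = k} \<in> events" by measurable
  show "prob {\<omega> \<in> space M. card (\<Xi> \<omega> \<inter> A) = k}
      = exp (- measure lborel A) * measure lborel A ^ k / fact k"
    using assms poisson by (auto simp: unit_poisson_process_def)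
qed

lemma home_index_realization_measurable [measurable]:
  "(\<lambda>\<omega>. home_index x (realization \<omega>)) \<in> measurable M (count_space UNIV)"
  by (rule measurable_compose[OF realization_measurable home_index_measurable])

lemma measure_strip: "measure lborel (box x (x + (real n, 1))) = real n" for x :: plane
  by (subst measure_lborel_box_eq) (auto simp: Basis_prod_def inner_add_left prod.union_disjoint)

text \<open>An unsuccessful search of \<open>n\<close> cells leaves an open strip of area
  \<open>n\<close> empty, so a single Poisson void probability covers all these cells at
  once.\<close>

lemma prob_home_index_ge:
  "prob {\<omega> \<in> space M. n \<le> home_index x (realization \<omega>)} \<le> exp (- real n)"
proof -
  let ?B = "box x (x + (real n, 1))"
  have "prob {\<omega> \<in> space M. card (\<Xi> \<omega> \<inter> ?B) = 0} = exp (- real n)"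
    using prob_card_points(2)[of ?B 0] by (simp add: measure_strip)
  moreover have "prob {\<omega> \<in> space M. n \<le> home_index x (realization \<omega>)}
      \<le> prob {\<omega> \<in> space M. card (\<Xi> \<omega> \<inter> ?B) = 0}"
    by (intro finite_measure_mono prob_card_points(1)) (auto simp: home_index_ge_imp_empty)
  ultimately show ?thesis by simp
qed

lemma home_nonempty: "AE \<omega> in M. \<Xi> \<omega> \<inter> home x (realization \<omega>) \<noteq> {}"
proof -
  define N where "N n = {\<omega> \<in> space M. card (\<Xi> \<omega> \<inter> box x (x + (real n, 1))) = 0}" for n
  have [measurable]: "N n \<in> events" for n unfolding N_def by (intro prob_card_points(1)) auto
  have pN: "prob (N n) = exp (- real n)" for n
    unfolding N_def by (subst prob_card_points(2)) (auto simp: measure_strip)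
  have "prob (\<Inter>n. N n) \<le> 0"
  proof (rule tendsto_lowerbound)
    show "(\<lambda>n. exp (- real n)) \<longlonglongrightarrow> 0"
      by (intro filterlim_compose[OF exp_at_bot] filterlim_compose[OF filterlim_uminus_at_bot_at_top]
          filterlim_real_sequentially)
    show "\<forall>\<^sub>F n in sequentially. prob (\<Inter>n. N n) \<le> exp (- real n)"
      unfolding pN[symmetric] by (intro always_eventually allI finite_measure_mono) auto
  qed simp
  then have "(\<Inter>n. N n) \<in> null_sets M"
    by (intro null_setsI) (auto simp: emeasure_eq_measure measure_le_0_iff)
  moreover have "\<Xi> \<omega> \<inter> home x (realization \<omega>) \<noteq> {}" if \<omega>: "\<omega> \<in> space M" "\<omega> \<notin> (\<Inter>n. N n)" for \<omega>
  proof -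
    obtain n where "\<omega> \<notin> N n" using \<omega> by auto
    then have "\<Xi> \<omega> \<inter> box x (x + (real n, 1)) \<noteq> {}" using \<omega> by (auto simp: N_def)
    then have ex: "\<exists>i. pair_count (cell x i) (cell x i) UNIV (realization \<omega>) \<noteq> 0"
      using occupied_cell[OF \<omega>(1)] by blast
    then have "pair_count (home x (realization \<omega>)) (home x (realization \<omega>)) UNIV (realization \<omega>) \<noteq> 0"
      unfolding home_def home_index_def by (rule LeastI_ex)
    then show ?thesis
      unfolding realization_def pair_count_def by (auto simp: card_gt_0_iff)
  qed
  ultimately show ?thesis by (intro AE_I') auto
qed

end

text \<open>The quadratic factor reflects the growth of second moments with the number of cells
  searched; the exponential is what remains of the search tail after the AM-GM split in
  \<open>home_dist_integral_bound\<close>. In the proof half of the exponent absorbs the quadratic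
  factor.\<close>

lemma summable_weight: "summable (\<lambda>n. (1 + real n)\<^sup>2 * exp (- real n / 4))"
proof (rule summable_comparison_test')
  show "summable (\<lambda>n. 256 * exp (1 / 8) * exp (- 1 / 8 :: real) ^ n)"
    by (intro summable_mult summable_geometric) simp
  fix n :: nat
  have "(1 + real n) / 16 \<le> exp ((1 + real n) / 16)"
    using exp_ge_add_one_self[of "(1 + real n) / 16"] by linarith
  then have "((1 + real n) / 16)\<^sup>2 \<le> (exp ((1 + real n) / 16))\<^sup>2"
    by (intro power_mono) auto
  also have "\<dots> = exp ((1 + real n) / 8)"
    by (simp add: power2_eq_square flip: exp_add)
  finally have "(1 + real n)\<^sup>2 \<le> 256 * exp ((1 + real n) / 8)"
    by (simp add: power2_eq_square)
  then have "(1 + real n)\<^sup>2 * exp (- real n / 4) \<le> 256 * exp ((1 + real n) / 8) * exp (- real n / 4)"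
    by (intro mult_right_mono) auto
  also have "\<dots> = 256 * exp (1 / 8) * exp (- 1 / 8) ^ n"
    by (simp add: field_simps flip: exp_of_nat_mult exp_add)
  finally show "norm ((1 + real n)\<^sup>2 * exp (- real n / 4)) \<le> 256 * exp (1 / 8) * exp (- 1 / 8) ^ n"
    by simp
qed

text \<open>AM-GM with a free scale \<open>l\<close>, the device that trades a first power for a
  second moment throughout.\<close>

lemma real_le_square_add:
  fixes x l :: real
  assumes "l > 0"
  shows "x \<le> x\<^sup>2 * (1 / l) + l"
proof -
  have "0 \<le> (x - l / 2)\<^sup>2 + 3 / 4 * l\<^sup>2" by (intro add_nonneg_nonneg) auto
  then have "x * l \<le> x\<^sup>2 + l\<^sup>2" by (simp add: power2_eq_square algebra_simps)
  then show ?thesis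
    using assms by (simp add: field_simps power2_eq_square)
qed

lemma ennreal_le_square_add:
  fixes a :: ennreal and l :: real
  assumes "l > 0"
  shows "a \<le> a\<^sup>2 * ennreal (1 / l) + ennreal l"
proof (cases a)
  case (real r)
  have "r \<le> r\<^sup>2 * (1 / l) + l" using assms by (rule real_le_square_add)
  then have "ennreal r \<le> ennreal (r\<^sup>2 * (1 / l) + l)" by (rule ennreal_leI)
  then show ?thesis
    using real assms by (simp add: ennreal_power flip: ennreal_mult ennreal_plus)
next
  case top
  then show ?thesis using assms by (simp add: ennreal_top_mult power2_eq_square)
qed

context poisson_metric
begin

text \<open>The mean is split over the two home indices \<open>i\<close>, \<open>j\<close>. On each
  piece AM-GM at scale \<open>l i j\<close> separates the second moment of a fixed pair of cells
  from the probability of these indices; both contributions are linear in \<open>R\<close> and decay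
  geometrically up to a quadratic factor.\<close>

lemma home_dist_integral_bound:
  obtains C where "C \<ge> 0"
    "\<And>x y. (\<integral>\<^sup>+ \<omega>. home_dist x y (realization \<omega>) \<partial>M) \<le> ennreal (C * max 1 (norm (y - x)))"
proof -
  obtain K where K: "K \<ge> 0"
    "\<And>a b. (\<integral>\<^sup>+ \<omega>. (sup_dist ((+) a ` cbox 0 (1, 1)) ((+) b ` cbox 0 (1, 1)) (realization \<omega>))\<^sup>2 \<partial>M)
        \<le> ennreal (K * (max 1 (norm (b - a)))\<^sup>2)"
    by (rule sup_dist_square_integral) blast
  define g where "g n = (1 + real n)\<^sup>2 * exp (- real n / 4)" for n :: nat
  have g0: "g n \<ge> 0" for n by (simp add: g_def)
  define \<sigma> where "\<sigma> = suminf g"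
  have g_sums: "(\<Sum>n. ennreal (c * g n)) = ennreal (c * \<sigma>)" if "c \<ge> 0" for c
    using that g0 summable_weight unfolding \<sigma>_def g_def[abs_def]
    by (subst suminf_ennreal2) (auto simp: suminf_mult intro!: summable_mult mult_nonneg_nonneg)
  have \<sigma>0: "\<sigma> \<ge> 0" unfolding \<sigma>_def using summable_weight g0
    by (intro suminf_nonneg) (simp_all add: g_def[abs_def])
  have "(\<integral>\<^sup>+ \<omega>. home_dist x y (realization \<omega>) \<partial>M) \<le> ennreal ((K + 1) * \<sigma> * \<sigma> * max 1 (norm (y - x)))"
    for x y
  proof -
    define R where "R = max 1 (norm (y - x))"
    have R: "R \<ge> 1" by (simp add: R_def)
    \<comment> \<open>The scale balances the two terms: the second moment divided by
      \<open>l\<close> gains \<open>exp (- (i + j) / 4)\<close>, while \<open>l\<close> times the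
      probability bound \<open>exp (- (i + j) / 2)\<close> loses only half of its decay.\<close>
    define l where "l i j = R * exp (real (i + j) / 4)" for i j :: nat
    have l: "l i j > 0" for i j using R by (simp add: l_def)
    define Y where "Y i j \<omega> = (sup_dist (cell x i) (cell y j) (realization \<omega>))\<^sup>2" for i j \<omega>
    define W where "W i j = {\<omega> \<in> space M. home_index x (realization \<omega>) = i \<and> home_index y (realization \<omega>) = j}"
      for i j
    have [measurable]: "Y i j \<in> borel_measurable M" for i j
    proof -
      have [measurable]: "sup_dist (cell x i) (cell y j) \<in> borel_measurable config_space"
        by (intro sup_dist_measurable) auto
      show ?thesis unfolding Y_def by measurable
    qed
    have [measurable]: "W i j \<in> events" for i j unfolding W_def by measurable
    \<comment> \<open>The indicator is kept only on the scale term. The second moment is taken over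
      the whole space, so that no joint law of distances and indices enters.\<close>
    define t where "t i j \<omega> = Y i j \<omega> * ennreal (1 / l i j) + ennreal (l i j) * indicator (W i j) \<omega>"
      for i j \<omega>
    have [measurable]: "t i j \<in> borel_measurable M" for i j unfolding t_def by measurable
    have le: "home_dist x y (realization \<omega>) \<le> (\<Sum>i. \<Sum>j. t i j \<omega>)" if \<omega>: "\<omega> \<in> space M" for \<omega>
    proof -
      define i where "i = home_index x (realization \<omega>)"
      define j where "j = home_index y (realization \<omega>)"
      have "home_dist x y (realization \<omega>) \<le> t i j \<omega>"
        using ennreal_le_square_add[OF l, of "home_dist x y (realization \<omega>)" i j] \<omega>
        by (simp add: t_def Y_def W_def home_dist_def home_def i_def j_def)
      also have "\<dots> \<le> (\<Sum>j. t i j \<omega>)"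
        using sum_le_suminf[of "\<lambda>j. t i j \<omega>" "{j}"] by simp
      also have "\<dots> \<le> (\<Sum>i. \<Sum>j. t i j \<omega>)"
        using sum_le_suminf[of "\<lambda>i. \<Sum>j. t i j \<omega>" "{i}"] by simp
      finally show ?thesis .
    qed
    \<comment> \<open>The smaller of the two tails is at most their geometric mean.\<close>
    have pW: "prob (W i j) \<le> exp (- real (i + j) / 2)" for i j
    proof -
      have "prob (W i j) \<le> exp (- real i)" "prob (W i j) \<le> exp (- real j)"
        by (rule order_trans[OF finite_measure_mono prob_home_index_ge]; force simp: W_def)+
      then have "prob (W i j) \<le> min (exp (- real i)) (exp (- real j))" by simp
      also have "\<dots> \<le> exp (- real (i + j) / 2)" by (auto simp: min_def)
      finally show ?thesis .
    qed
    have tint: "(\<integral>\<^sup>+ \<omega>. t i j \<omega> \<partial>M) \<le> ennreal ((K + 1) * R * g i * g j)" for i j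
    proof -
      define b where "b = 1 + real (i + j)"
      have b: "b \<ge> 1" by (simp add: b_def)
      define \<tau> where "\<tau> = real (i + j) / 4"
      define q where "q = exp (- \<tau>)"
      have eq: "- real (i + j) / 4 = - \<tau>" "- real (i + j) / 2 = - \<tau> + - \<tau>"
        unfolding \<tau>_def by linarith+
      have q: "q > 0" "l i j = R / q" "exp (- real (i + j) / 2) = q * q" "exp (- real (i + j) / 4) = q"
        unfolding eq exp_add l_def \<tau>_def[symmetric] q_def
        by (simp_all add: exp_minus divide_inverse)
      have nrm: "max 1 (norm (y + (real j, 0) - (x + (real i, 0)))) \<le> R * b"
      proof -
        have "norm (y + (real j, 0) - (x + (real i, 0))) = norm ((y - x) + ((real j, 0) - (real i, 0)))"
          by (intro arg_cong[of _ _ norm] add_diff_add)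
        also have "\<dots> \<le> norm (y - x) + (norm (real j, 0::real) + norm (real i, 0::real))"
          by (intro order_trans[OF norm_triangle_ineq] add_left_mono norm_triangle_ineq4)
        also have "\<dots> = norm (y - x) + real (i + j)" by (simp add: norm_Pair)
        also have "\<dots> \<le> R + R * real (i + j)"
          using R mult_right_mono[of 1 R "real (i + j)"] by (intro add_mono) (auto simp: R_def)
        also have "\<dots> = R * b" by (simp add: b_def distrib_left)
        finally have "norm (y + (real j, 0) - (x + (real i, 0))) \<le> R * b" .
        moreover have "1 \<le> R * b" using R b mult_mono[of 1 R 1 b] by simp
        ultimately show ?thesis by simp
      qed
      have "(\<integral>\<^sup>+ \<omega>. Y i j \<omega> \<partial>M) \<le> ennreal (K * (max 1 (norm (y + (real j, 0) - (x + (real i, 0)))))\<^sup>2)"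
        unfolding Y_def cell_def by (rule K(2))
      also have "\<dots> \<le> ennreal (K * (R * b)\<^sup>2)"
        using K(1) nrm by (intro ennreal_leI mult_left_mono power_mono) auto
      finally have Y: "(\<integral>\<^sup>+ \<omega>. Y i j \<omega> \<partial>M) \<le> ennreal (K * (R * b)\<^sup>2)" .
      have "(\<integral>\<^sup>+ \<omega>. t i j \<omega> \<partial>M) = (\<integral>\<^sup>+ \<omega>. Y i j \<omega> \<partial>M) * ennreal (1 / l i j) + ennreal (l i j) * emeasure M (W i j)"
        unfolding t_def by (subst nn_integral_add) (auto simp: nn_integral_multc nn_integral_cmult_indicator)
      also have "\<dots> \<le> ennreal (K * (R * b)\<^sup>2) * ennreal (1 / l i j) + ennreal (l i j) * ennreal (exp (- real (i + j) / 2))"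
        using Y pW[of i j] by (intro add_mono mult_mono) (auto simp: emeasure_eq_measure ennreal_leI)
      also have "\<dots> = ennreal (K * (R * b)\<^sup>2 * (1 / l i j) + l i j * exp (- real (i + j) / 2))"
        using K(1) l[of i j] by (simp add: ennreal_plus ennreal_mult[symmetric] del: ennreal_plus[symmetric])
      also have "K * (R * b)\<^sup>2 * (1 / l i j) = K * R * b\<^sup>2 * exp (- real (i + j) / 4)"
        unfolding q(2,4) using R q(1) by (simp add: power2_eq_square field_simps)
      also have "l i j * exp (- real (i + j) / 2) = R * exp (- real (i + j) / 4)"
        unfolding q(2,3,4) using q(1) by simp
      also have "K * R * b\<^sup>2 * exp (- real (i + j) / 4) + R * exp (- real (i + j) / 4)
          \<le> K * R * b\<^sup>2 * exp (- real (i + j) / 4) + R * b\<^sup>2 * exp (- real (i + j) / 4)"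
        using R b by (intro add_left_mono mult_right_mono) (auto simp: power2_eq_square intro!: mult_le_cancel_left1[THEN iffD2] mult_ge1_I)
      also have "\<dots> = (K + 1) * R * exp (- real (i + j) / 4) * b\<^sup>2" by (simp add: algebra_simps)
      \<comment> \<open>Bounding \<open>1 + i + j\<close> by \<open>(1 + i) * (1 + j)\<close> makes
        the double series a product of two single ones.\<close>
      also have "\<dots> \<le> (K + 1) * R * exp (- real (i + j) / 4) * ((1 + real i) * (1 + real j))\<^sup>2"
        using K(1) R by (intro mult_left_mono power_mono) (auto simp: b_def algebra_simps)
      also have "\<dots> = (K + 1) * R * g i * g j"
      proof -
        have "- real (i + j) / 4 = - real i / 4 + - real j / 4" by simp
        then show ?thesis
          unfolding g_def power_mult_distrib by (simp only: exp_add mult_ac)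
      qed
      finally show ?thesis by (simp add: ennreal_leI)
    qed
    have "(\<integral>\<^sup>+ \<omega>. home_dist x y (realization \<omega>) \<partial>M) \<le> (\<integral>\<^sup>+ \<omega>. (\<Sum>i. \<Sum>j. t i j \<omega>) \<partial>M)"
      by (intro nn_integral_mono le)
    also have "\<dots> = (\<Sum>i. \<Sum>j. \<integral>\<^sup>+ \<omega>. t i j \<omega> \<partial>M)"
      by (simp add: nn_integral_suminf)
    also have "\<dots> \<le> (\<Sum>i. \<Sum>j. ennreal ((K + 1) * R * g i * g j))"
      by (intro suminf_le tint summableI)
    also have "\<dots> = (\<Sum>i. ennreal (((K + 1) * R * \<sigma>) * g i))"
      using K(1) R g0 by (subst g_sums) (auto simp: mult_ac)
    also have "\<dots> = ennreal ((K + 1) * R * \<sigma> * \<sigma>)"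
      using K(1) R \<sigma>0 by (subst g_sums) auto
    finally show ?thesis by (simp add: R_def mult_ac)
  qed
  then show ?thesis using K(1) \<sigma>0 by (intro that[of "(K + 1) * \<sigma> * \<sigma>"]) auto
qed

section \<open>Distances between deterministic locations and their means\<close>

definition occupied :: "plane \<Rightarrow> 'w \<Rightarrow> bool" where
  "occupied x \<omega> \<longleftrightarrow> \<omega> \<in> space M \<and> \<Xi> \<omega> \<inter> home x (realization \<omega>) \<noteq> {}"

lemma AE_occupied: "AE \<omega> in M. occupied x \<omega>"
  using home_nonempty[of x] AE_space by eventually_elim (simp add: occupied_def)

lemma bounded_home [simp]: "bounded (home x s)"
  by (simp add: home_def)

lemma D_measurable [measurable]: "D x y \<in> borel_measurable M"
  unfolding D_def by (intro borel_measurable_enn2real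
      measurable_compose[OF realization_measurable home_dist_measurable])

lemma D_nonneg [simp]: "0 \<le> D x y \<omega>"
  by (simp add: D_def)

lemma ennreal_D: "\<omega> \<in> space M \<Longrightarrow> ennreal (D x y \<omega>) = home_dist x y (realization \<omega>)"
  unfolding D_def home_dist_def using sup_dist_finite[of \<omega>]
  by (intro ennreal_enn2real) auto

lemma D_ge:
  assumes "\<omega> \<in> space M" "\<xi> \<in> \<Xi> \<omega> \<inter> home x (realization \<omega>)" "\<xi>' \<in> \<Xi> \<omega> \<inter> home y (realization \<omega>)"
  shows "d \<omega> \<xi> \<xi>' \<le> D x y \<omega>"
proof -
  have "ennreal (d \<omega> \<xi> \<xi>') \<le> ennreal (D x y \<omega>)"
    unfolding ennreal_D[OF assms(1)] home_dist_def using assms by (intro sup_dist_ge)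
  then show ?thesis by simp
qed

lemma D_attained:
  assumes "occupied x \<omega>" "occupied y \<omega>"
  obtains \<xi> \<xi>' where "\<xi> \<in> \<Xi> \<omega> \<inter> home x (realization \<omega>)" "\<xi>' \<in> \<Xi> \<omega> \<inter> home y (realization \<omega>)"
    "D x y \<omega> = d \<omega> \<xi> \<xi>'"
proof -
  have \<omega>: "\<omega> \<in> space M" using assms by (simp add: occupied_def)
  have "bounded (home x (realization \<omega>))" "bounded (home y (realization \<omega>))" by simp_all
  with \<omega> show ?thesis
  proof (cases rule: sup_dist_cases)
    case (2 \<xi> \<xi>')
    then have "ennreal (D x y \<omega>) = ennreal (d \<omega> \<xi> \<xi>')" using ennreal_D[OF \<omega>] by (simp add: home_dist_def)
    then have "D x y \<omega> = d \<omega> \<xi> \<xi>'" using nonneg[OF \<omega>, of \<xi> \<xi>'] 2 by simp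
    then show ?thesis using 2 that by blast
  qed (use assms in \<open>auto simp: occupied_def\<close>)
qed

lemma D_commute:
  assumes "occupied x \<omega>" "occupied y \<omega>"
  shows "D x y \<omega> = D y x \<omega>"
proof -
  have "D x y \<omega> \<le> D y x \<omega>" if *: "occupied x \<omega>" "occupied y \<omega>" for x y
    using D_attained[OF *] D_ge symm * unfolding occupied_def by (metis IntD1)
  with assms show ?thesis by (intro antisym)
qed

lemma D_triangle:
  assumes "occupied x \<omega>" "occupied y \<omega>" "occupied z \<omega>"
  shows "D x z \<omega> \<le> D x y \<omega> + D y z \<omega>"
proof -
  have \<omega>: "\<omega> \<in> space M" using assms by (simp add: occupied_def)
  obtain \<xi> \<xi>' where 1: "\<xi> \<in> \<Xi> \<omega> \<inter> home x (realization \<omega>)" "\<xi>' \<in> \<Xi> \<omega> \<inter> home z (realization \<omega>)"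
    "D x z \<omega> = d \<omega> \<xi> \<xi>'"
    using assms D_attained by blast
  obtain \<eta> where 2: "\<eta> \<in> \<Xi> \<omega> \<inter> home y (realization \<omega>)"
    using assms by (auto simp: occupied_def)
  show ?thesis
    using triangle[OF \<omega>, of \<xi> \<eta> \<xi>'] D_ge[OF \<omega> 1(1) 2] D_ge[OF \<omega> 2 1(2)] 1 2 by simp
qed

lemma integrable_D [simp]: "integrable M (D x y)"
proof -
  obtain C where C: "\<And>x y. (\<integral>\<^sup>+ \<omega>. home_dist x y (realization \<omega>) \<partial>M) \<le> ennreal (C * max 1 (norm (y - x)))"
    by (rule home_dist_integral_bound) blast
  have "(\<integral>\<^sup>+ \<omega>. ennreal (norm (D x y \<omega>)) \<partial>M) = (\<integral>\<^sup>+ \<omega>. home_dist x y (realization \<omega>) \<partial>M)"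
    by (intro nn_integral_cong) (simp add: ennreal_D)
  also have "\<dots> < \<infinity>" using C[of x y] by (metis ennreal_less_top infinity_ennreal_def le_less_trans)
  finally show ?thesis by (intro integrableI_bounded) auto
qed

text \<open>Stated with a function \<open>h\<close> because truncation remainders
  \<open>t - min b t\<close> are shifted later, besides \<open>D\<close> itself.\<close>

lemma expectation_D_shift:
  assumes [measurable]: "h \<in> borel_measurable borel"
  shows "expectation (\<lambda>\<omega>. h (D (x + v) (y + v) \<omega>) :: real) = expectation (\<lambda>\<omega>. h (D x y \<omega>))"
proof -
  let ?h = "\<lambda>s. h (enn2real (home_dist (x + v) (y + v) s))"
  have hm [measurable]: "?h \<in> borel_measurable config_space" by measurable
  have T: "translate v \<in> measurable law law" "distr law law (translate v) = law"
    using law_preserving by (auto simp: measure_preserving_map_def)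
  have [measurable]: "translate v \<in> measurable config_space config_space"
    by (rule measurable_translate)
  have "expectation (\<lambda>\<omega>. h (D (x + v) (y + v) \<omega>)) = (\<integral>s. ?h s \<partial>law)"
    unfolding law_def D_def by (subst integral_distr) auto
  also have "\<dots> = (\<integral>s. ?h s \<partial>distr law law (translate v))"
    using T by simp
  also have "\<dots> = (\<integral>s. ?h (translate v s) \<partial>law)"
    using T hm by (subst integral_distr) (auto simp: law_measurable)
  also have "\<dots> = expectation (\<lambda>\<omega>. h (D x y \<omega>))"
    unfolding law_def D_def by (subst integral_distr) (auto simp: home_dist_translate)
  finally show ?thesis .
qed

definition \<gamma> :: "plane \<Rightarrow> real" where
  "\<gamma> z = expectation (D 0 z)"

lemma expectation_D: "expectation (D x y) = \<gamma> (y - x)"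
  using expectation_D_shift[of "\<lambda>t. t" 0 x "y - x"] by (simp add: \<gamma>_def)

lemma \<gamma>_nonneg [simp]: "0 \<le> \<gamma> z"
  unfolding \<gamma>_def by (intro integral_nonneg_AE) auto

lemma \<gamma>_add: "\<gamma> (a + b) \<le> \<gamma> a + \<gamma> b"
proof -
  have "expectation (D 0 (a + b)) \<le> expectation (\<lambda>\<omega>. D 0 a \<omega> + D a (a + b) \<omega>)"
    using AE_occupied[of 0] AE_occupied[of a] AE_occupied[of "a + b"]
    by (intro integral_mono_AE) (auto elim!: eventually_elim2 intro: D_triangle)
  also have "\<dots> = \<gamma> a + \<gamma> b" by (simp add: expectation_D)
  finally show ?thesis by (simp add: \<gamma>_def)
qed

lemma \<gamma>_bound:
  obtains C where "C \<ge> 0" "\<And>z. \<gamma> z \<le> C * max 1 (norm z)"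
proof -
  obtain C where C: "C \<ge> 0"
    "\<And>x y. (\<integral>\<^sup>+ \<omega>. home_dist x y (realization \<omega>) \<partial>M) \<le> ennreal (C * max 1 (norm (y - x)))"
    by (rule home_dist_integral_bound) blast
  have "\<gamma> z \<le> C * max 1 (norm z)" for z
  proof -
    have "ennreal (\<gamma> z) = (\<integral>\<^sup>+ \<omega>. ennreal (D 0 z \<omega>) \<partial>M)"
      unfolding \<gamma>_def by (rule nn_integral_eq_integral[symmetric]) auto
    also have "\<dots> = (\<integral>\<^sup>+ \<omega>. home_dist 0 z (realization \<omega>) \<partial>M)"
      by (intro nn_integral_cong ennreal_D)
    also have "\<dots> \<le> ennreal (C * max 1 (norm z))" using C(2)[of 0 z] by simp
    finally show ?thesis using C(1) by (simp add: ennreal_le_iff)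
  qed
  then show ?thesis using C(1) that by blast
qed

text \<open>The induction starts at 1: \<open>\<gamma> 0\<close> is the mean diameter of the points
  in a cell and need not vanish.\<close>

lemma \<gamma>_mult: "m \<ge> 1 \<Longrightarrow> \<gamma> (real m *\<^sub>R v) \<le> real m * \<gamma> v"
proof (induction m rule: dec_induct)
  case (step m)
  have "\<gamma> (real (Suc m) *\<^sub>R v) \<le> \<gamma> v + \<gamma> (real m *\<^sub>R v)"
    using \<gamma>_add[of v "real m *\<^sub>R v"] by (simp add: scaleR_add_left)
  with step show ?case by (simp add: algebra_simps)
qed simp

end

section \<open>Subadditivity and the rate\<close>

context poisson_metric
begin

text \<open>Translating the configuration by \<open>- j v\<close> brings the step from
  \<open>j v\<close> to \<open>(j + 1) v\<close> back to the step from 0 to \<open>v\<close>. The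
  sum is therefore an orbit sum under \<open>translate (- v)\<close>, and
  \<open>ergodic_upper_bound\<close> applies on the law.\<close>

lemma truncated_mean:
  assumes v: "v \<noteq> 0" and b: "b \<ge> 0" and e: "e > 0"
  shows "(\<lambda>m. prob {\<omega> \<in> space M. (\<Sum>j<m. min b (D (real j *\<^sub>R v) (real (Suc j) *\<^sub>R v) \<omega>))
    > real m * (expectation (\<lambda>\<omega>. min b (D 0 v \<omega>)) + e)}) \<longlonglongrightarrow> 0"
proof -
  interpret L: prob_space law by (rule prob_space_law)
  define f where "f s = min b (enn2real (home_dist 0 v s))" for s
  have f [measurable]: "f \<in> borel_measurable config_space" unfolding f_def by measurable
  have [measurable]: "translate w \<in> measurable config_space config_space" for w
    by (rule measurable_translate)
  have os: "orbit_sum (translate (- v)) f m (realization \<omega>)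
      = (\<Sum>j<m. min b (D (real j *\<^sub>R v) (real (Suc j) *\<^sub>R v) \<omega>))" for m \<omega>
    by (simp add: orbit_sum_def f_def D_def translate_funpow home_dist_translate scaleR_add_left)
  have Ef: "L.expectation f = expectation (\<lambda>\<omega>. min b (D 0 v \<omega>))"
    unfolding law_def f_def D_def by (subst integral_distr) auto
  have osm: "orbit_sum (translate (- v)) f m \<in> borel_measurable config_space" for m
    unfolding orbit_sum_def translate_funpow by measurable
  have "(\<lambda>m. L.prob {s \<in> space law. orbit_sum (translate (- v)) f m s
      > real m * (L.expectation f + e)}) \<longlonglongrightarrow> 0"
    using v b e f by (intro L.ergodic_upper_bound[where b = b] law_ergodic) (auto simp: law_measurable f_def)
  moreover have "L.prob {s \<in> space law. orbit_sum (translate (- v)) f m s > real m * (L.expectation f + e)}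
     = prob {\<omega> \<in> space M. (\<Sum>j<m. min b (D (real j *\<^sub>R v) (real (Suc j) *\<^sub>R v) \<omega>))
    > real m * (expectation (\<lambda>\<omega>. min b (D 0 v \<omega>)) + e)}" for m
  proof -
    have "{s \<in> space config_space. orbit_sum (translate (- v)) f m s > real m * (L.expectation f + e)}
        \<in> sets config_space"
      using osm[of m] by measurable
    then have "L.prob {s \<in> space config_space. orbit_sum (translate (- v)) f m s > real m * (L.expectation f + e)}
      = prob (realization -` {s \<in> space config_space. orbit_sum (translate (- v)) f m s
          > real m * (L.expectation f + e)} \<inter> space M)"
      unfolding law_def by (intro measure_distr) auto
    also have "realization -` {s \<in> space config_space. orbit_sum (translate (- v)) f m s
          > real m * (L.expectation f + e)} \<inter> space M
       = {\<omega> \<in> space M. (\<Sum>j<m. min b (D (real j *\<^sub>R v) (real (Suc j) *\<^sub>R v) \<omega>))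
          > real m * (expectation (\<lambda>\<omega>. min b (D 0 v \<omega>)) + e)}"
      using realization_configs by (auto simp: os Ef)
    finally show ?thesis by (simp add: law_measurable)
  qed
  ultimately show ?thesis by simp
qed

text \<open>The case \<open>m = 0\<close> is excluded because \<open>D 0 0\<close> is the diameter of a cell, not \<open>0\<close>.\<close>

lemma D_chain: "AE \<omega> in M. \<forall>m\<ge>1. D 0 (real m *\<^sub>R v) \<omega> \<le> (\<Sum>j<m. D (real j *\<^sub>R v) (real (Suc j) *\<^sub>R v) \<omega>)"
proof -
  have "AE \<omega> in M. \<forall>j::nat. occupied (real j *\<^sub>R v) \<omega>"
    by (subst AE_all_countable) (simp add: AE_occupied)
  then show ?thesis
  proof eventually_elim
    case (elim \<omega>)
    show ?case
    proof (intro allI impI)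
      fix m :: nat assume "m \<ge> 1"
      then show "D 0 (real m *\<^sub>R v) \<omega> \<le> (\<Sum>j<m. D (real j *\<^sub>R v) (real (Suc j) *\<^sub>R v) \<omega>)"
      proof (induction m rule: dec_induct)
        case (step m)
        have "D 0 (real (Suc m) *\<^sub>R v) \<omega> \<le> D 0 (real m *\<^sub>R v) \<omega> + D (real m *\<^sub>R v) (real (Suc m) *\<^sub>R v) \<omega>"
          using elim[rule_format, of 0] elim[rule_format, of m] elim[rule_format, of "Suc m"]
          by (intro D_triangle) (simp_all del: of_nat_Suc)
        with step show ?case by (simp del: of_nat_Suc)
      qed simp
    qed
  qed
qed

text \<open>Each step of the chain is cut at height \<open>b\<close>. The parts above
  \<open>b\<close> have small mean by dominated convergence; the sum of the parts below exceeds
  \<open>m * (\<mu> + e / 3)\<close> only on \<open>A m\<close>, where it is still at most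
  \<open>m * b\<close>. The three thirds of \<open>e\<close> pay for the truncation, for the ergodic
  error, and for \<open>b\<close> times the vanishing probability of \<open>A m\<close>.\<close>

lemma kingman_upper:
  assumes v: "v \<noteq> 0" and e: "e > 0"
  shows "\<forall>\<^sub>F m in sequentially.
    expectation (\<lambda>\<omega>. max 0 (D 0 (real m *\<^sub>R v) \<omega> - real m * \<gamma> v)) \<le> real m * e"
proof -
  have "(\<lambda>n. expectation (\<lambda>\<omega>. D 0 v \<omega> - min (real n) (D 0 v \<omega>))) \<longlonglongrightarrow> expectation (\<lambda>\<omega>. 0)"
  proof (rule integral_dominated_convergence[where w = "D 0 v"])
    show "AE \<omega> in M. (\<lambda>n. D 0 v \<omega> - min (real n) (D 0 v \<omega>)) \<longlonglongrightarrow> 0"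
    proof (rule AE_I2)
      fix \<omega>
      have "\<forall>\<^sub>F n in sequentially. real n \<ge> D 0 v \<omega>"
        using filterlim_real_sequentially by (simp add: filterlim_at_top)
      then show "(\<lambda>n. D 0 v \<omega> - min (real n) (D 0 v \<omega>)) \<longlonglongrightarrow> 0"
        by (intro tendsto_eventually) (auto elim!: eventually_mono)
    qed
  qed (auto simp: abs_if min_def)
  then have "\<forall>\<^sub>F n in sequentially. expectation (\<lambda>\<omega>. D 0 v \<omega> - min (real n) (D 0 v \<omega>)) < e / 3"
    using e by (intro order_tendstoD(2)) auto
  then obtain n where n: "expectation (\<lambda>\<omega>. D 0 v \<omega> - min (real n) (D 0 v \<omega>)) < e / 3"
    by (auto simp: eventually_sequentially)
  define b where "b = real n"
  have b: "b \<ge> 0" by (simp add: b_def)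
  define X where "X j = D (real j *\<^sub>R v) (real (Suc j) *\<^sub>R v)" for j :: nat
  have X [measurable, simp]: "X j \<in> borel_measurable M" "integrable M (X j)" "0 \<le> X j \<omega>" for j \<omega>
    unfolding X_def by auto
  define \<mu> where "\<mu> = expectation (\<lambda>\<omega>. min b (D 0 v \<omega>))"
  have mint: "integrable M (\<lambda>\<omega>. min b (D x y \<omega>))" for x y
    using b by (intro Bochner_Integration.integrable_bound[OF integrable_D[of x y]]) auto
  have \<mu>: "\<mu> \<le> \<gamma> v" unfolding \<mu>_def \<gamma>_def by (intro integral_mono mint) auto
  define A where "A m = {\<omega> \<in> space M. (\<Sum>j<m. min b (X j \<omega>)) > real m * (\<mu> + e / 3)}" for m
  have A [measurable]: "A m \<in> events" for m
    unfolding A_def by measurable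
  have "(\<lambda>m. prob (A m)) \<longlonglongrightarrow> 0"
    unfolding A_def X_def \<mu>_def using v b e by (intro truncated_mean) auto
  then have "(\<lambda>m. b * prob (A m)) \<longlonglongrightarrow> b * 0" by (intro tendsto_intros)
  then have "\<forall>\<^sub>F m in sequentially. b * prob (A m) < e / 3"
    using e by (intro order_tendstoD(2)) auto
  then show ?thesis
    using eventually_ge_at_top[of 1]
  proof eventually_elim
    case (elim m)
    let ?R = "\<lambda>\<omega>. (\<Sum>j<m. X j \<omega> - min b (X j \<omega>)) + (real m * (e / 3) + real m * b * indicator (A m) \<omega>)"
    have iX: "integrable M (\<lambda>\<omega>. X j \<omega> - min b (X j \<omega>))" for j
      unfolding X_def by (intro Bochner_Integration.integrable_diff mint) simp
    have iA: "integrable M (\<lambda>\<omega>. indicat_real (A m) \<omega>)"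
      by (intro integrable_real_indicator) (auto simp: emeasure_eq_measure)
    have EX: "expectation (\<lambda>\<omega>. X j \<omega> - min b (X j \<omega>)) \<le> e / 3" for j
    proof -
      have "expectation (\<lambda>\<omega>. X j \<omega> - min b (X j \<omega>)) = expectation (\<lambda>\<omega>. D 0 v \<omega> - min b (D 0 v \<omega>))"
        using expectation_D_shift[of "\<lambda>t. t - min b t" 0 "real j *\<^sub>R v" v]
        by (simp add: X_def scaleR_add_left)
      then show ?thesis using n by (simp add: b_def)
    qed
    have "expectation (\<lambda>\<omega>. max 0 (D 0 (real m *\<^sub>R v) \<omega> - real m * \<gamma> v)) \<le> expectation ?R"
    proof (rule integral_mono_AE)
      show "integrable M ?R"
        using iX iA by (intro Bochner_Integration.integrable_add Bochner_Integration.integrable_sum integrable_mult_right) auto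
      show "AE \<omega> in M. max 0 (D 0 (real m *\<^sub>R v) \<omega> - real m * \<gamma> v) \<le> ?R \<omega>"
        using D_chain[of v] AE_space
      proof eventually_elim
        case (elim \<omega>)
        have 1: "D 0 (real m *\<^sub>R v) \<omega> \<le> (\<Sum>j<m. X j \<omega> - min b (X j \<omega>)) + (\<Sum>j<m. min b (X j \<omega>))"
          using elim \<open>1 \<le> m\<close> by (simp add: X_def sum_subtractf)
        have 2: "0 \<le> (\<Sum>j<m. X j \<omega> - min b (X j \<omega>))" by (intro sum_nonneg) auto
        have 3: "0 \<le> real m * \<gamma> v" by simp
        have 4: "(\<Sum>j<m. min b (X j \<omega>)) \<le> real m * b"
          using sum_bounded_above[of "{..<m}" "\<lambda>j. min b (X j \<omega>)" b] by simp
        have 5: "(\<Sum>j<m. min b (X j \<omega>)) \<le> real m * \<gamma> v + real m * (e / 3)" if "\<omega> \<notin> A m"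
        proof -
          have "(\<Sum>j<m. min b (X j \<omega>)) \<le> real m * (\<mu> + e / 3)" using that elim by (simp add: A_def not_less)
          also have "\<dots> \<le> real m * (\<gamma> v + e / 3)" using \<mu> by (intro mult_left_mono) auto
          finally show ?thesis by (simp add: distrib_left)
        qed
        have 6: "0 \<le> real m * (e / 3)" "0 \<le> real m * b" using e b by auto
        show ?case
        proof (cases "\<omega> \<in> A m")
          case True
          then have "indicat_real (A m) \<omega> = 1" by simp
          then show ?thesis using 1 2 3 4 6 by (simp only: mult_1_right max_def split: if_split) linarith
        next
          case False
          then have "indicat_real (A m) \<omega> = 0" by simp
          then show ?thesis using 1 2 5[OF False] 6 by (simp only: mult_zero_right max_def split: if_split) linarith
        qed
      qed
    qed auto
    also have "\<dots> = (\<Sum>j<m. expectation (\<lambda>\<omega>. X j \<omega> - min b (X j \<omega>))) + (real m * (e / 3) + real m * b * prob (A m))"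
    proof -
      have "expectation ?R = expectation (\<lambda>\<omega>. \<Sum>j<m. X j \<omega> - min b (X j \<omega>))
          + expectation (\<lambda>\<omega>. real m * (e / 3) + real m * b * indicator (A m) \<omega>)"
        using iX iA by (intro Bochner_Integration.integral_add Bochner_Integration.integrable_sum) auto
      moreover have "expectation (\<lambda>\<omega>. \<Sum>j<m. X j \<omega> - min b (X j \<omega>))
          = (\<Sum>j<m. expectation (\<lambda>\<omega>. X j \<omega> - min b (X j \<omega>)))"
        using iX by (intro Bochner_Integration.integral_sum) auto
      moreover have "expectation (\<lambda>\<omega>. real m * (e / 3) + real m * b * indicator (A m) \<omega>)
          = real m * (e / 3) + real m * b * prob (A m)"
        using iA by (simp add: prob_space)
      ultimately show ?thesis by (simp only:)
    qed
    also have "\<dots> \<le> real m * (e / 3) + (real m * (e / 3) + real m * (e / 3))"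
    proof (intro add_mono)
      show "(\<Sum>j<m. expectation (\<lambda>\<omega>. X j \<omega> - min b (X j \<omega>))) \<le> real m * (e / 3)"
        using sum_bounded_above[of "{..<m}" _ "e / 3"] EX by simp
      show "real m * b * prob (A m) \<le> real m * (e / 3)"
        using elim(1) unfolding mult.assoc by (intro mult_left_mono) auto
    qed simp
    finally show ?case by (simp add: mult.commute)
  qed
qed

text \<open>The time constant of first passage percolation. As an infimum over all real scales it
  bounds every mean along the ray from below, and \<open>rate_approx\<close> supplies a near-optimal
  step length.\<close>

definition rate :: "plane \<Rightarrow> real" where
  "rate u = Inf ((\<lambda>t. \<gamma> (t *\<^sub>R u) / t) ` {0<..})"

lemma rate_le: "t > 0 \<Longrightarrow> rate u \<le> \<gamma> (t *\<^sub>R u) / t"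
  unfolding rate_def by (intro cInf_lower bdd_belowI[of _ 0]) auto

lemma rate_nonneg [simp]: "0 \<le> rate u"
  unfolding rate_def by (intro cInf_greatest) auto

lemma rate_approx:
  assumes "e > 0"
  obtains t where "t > 0" "\<gamma> (t *\<^sub>R u) \<le> t * (rate u + e)"
proof -
  have "Inf ((\<lambda>t. \<gamma> (t *\<^sub>R u) / t) ` {0<..}) < rate u + e"
    using assms unfolding rate_def by simp
  then obtain t where "t > 0" "\<gamma> (t *\<^sub>R u) / t < rate u + e"
    by (subst (asm) cInf_less_iff) (auto intro!: bdd_belowI[of _ 0])
  then show ?thesis by (intro that[of t]) (auto simp: field_simps)
qed

text \<open>Both directions are compared at one large scale \<open>T\<close>: going to
  \<open>T w\<close> by way of \<open>T u\<close> costs a detour whose mean is linear in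
  \<open>T * norm (w - u)\<close>, up to a constant.\<close>

lemma rate_lipschitz:
  assumes C: "C \<ge> 0" "\<And>z. \<gamma> z \<le> C * max 1 (norm z)"
  shows "\<bar>rate u - rate w\<bar> \<le> C * norm (u - w)"
proof -
  have "rate w \<le> rate u + C * norm (w - u)" for u w
  proof (rule field_le_epsilon)
    fix e :: real assume e: "e > 0"
    then obtain t where t: "t > 0" "\<gamma> (t *\<^sub>R u) \<le> t * (rate u + e / 2)"
      using rate_approx[of "e / 2" u] by auto
    \<comment> \<open>Multiples of a near-optimal scale stay near-optimal by subadditivity, so
      \<open>T\<close> may be taken large enough for \<open>e / 2\<close> per unit length to absorb
      the constant \<open>C\<close> coming from \<open>max 1\<close>.\<close>
    obtain m :: nat where m: "m * (t * e / 2) > C"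
      using reals_Archimedean3[of "t * e / 2"] t e by auto
    then have m1: "m \<ge> 1" using C by (cases m) auto
    define T where "T = real m * t"
    have T: "T > 0" "C \<le> T * e / 2" using m1 t m by (auto simp: T_def)
    have "\<gamma> (T *\<^sub>R w) \<le> \<gamma> (T *\<^sub>R u) + \<gamma> (T *\<^sub>R (w - u))"
      using \<gamma>_add[of "T *\<^sub>R u" "T *\<^sub>R (w - u)"] by (simp flip: scaleR_add_right)
    also have "\<gamma> (T *\<^sub>R u) \<le> real m * (t * (rate u + e / 2))"
      using order_trans[OF \<gamma>_mult[OF m1, of "t *\<^sub>R u"] mult_left_mono[OF t(2)]] by (simp add: T_def)
    also have "\<gamma> (T *\<^sub>R (w - u)) \<le> C * (1 + T * norm (w - u))"
      by (rule order_trans[OF C(2)]) (use C T in \<open>auto intro!: mult_left_mono\<close>)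
    finally have "\<gamma> (T *\<^sub>R w) \<le> T * (rate u + e / 2) + C + T * (C * norm (w - u))"
      by (simp add: T_def algebra_simps)
    also have "\<dots> \<le> T * (rate u + e + C * norm (w - u))"
      using T by (simp add: algebra_simps)
    finally have "\<gamma> (T *\<^sub>R w) / T \<le> rate u + e + C * norm (w - u)"
      using T by (simp add: field_simps)
    then show "rate w \<le> rate u + C * norm (w - u) + e"
      using rate_le[OF T(1), of w] by simp
  qed
  from this[of u w] this[of w u] show ?thesis by (simp add: norm_minus_commute abs_le_iff)
qed

section \<open>Convergence in mean along rays and in all directions\<close>

lemma convergence_on_ray:
  assumes u: "norm u = 1" and t: "t > 0" and e: "e > 0" and le: "\<gamma> (t *\<^sub>R u) \<le> t * (rate u + e)"
  shows "\<forall>\<^sub>F m in sequentially.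
    expectation (\<lambda>\<omega>. \<bar>D 0 (real m *\<^sub>R t *\<^sub>R u) \<omega> - real m * t * rate u\<bar>) \<le> 4 * e * (real m * t)"
proof -
  have "t *\<^sub>R u \<noteq> 0" "t * e > 0" using u t e by auto
  from kingman_upper[OF this] show ?thesis
    using eventually_ge_at_top[of 1]
  proof eventually_elim
    case (elim m)
    let ?D = "D 0 (real m *\<^sub>R t *\<^sub>R u)"
    let ?P = "\<lambda>\<omega>. max 0 (?D \<omega> - real m * \<gamma> (t *\<^sub>R u))"
    have iP: "integrable M ?P" by (intro integrable_max) auto
    have mt: "real m * t > 0" using elim t by simp
    have "expectation (\<lambda>\<omega>. \<bar>?D \<omega> - real m * t * rate u\<bar>)
      \<le> expectation (\<lambda>\<omega>. 2 * (?P \<omega> + real m * (t * e)) - (?D \<omega> - real m * t * rate u))"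
    proof (rule integral_mono)
      fix \<omega>
      have "real m * \<gamma> (t *\<^sub>R u) \<le> real m * (t * (rate u + e))"
        using le by (intro mult_left_mono) auto
      then have "real m * \<gamma> (t *\<^sub>R u) \<le> real m * t * rate u + real m * (t * e)"
        by (simp add: algebra_simps)
      moreover have "0 \<le> real m * (t * e)" using t e by simp
      \<comment> \<open>An absolute value is twice the positive part minus the number itself. After
        integration the subtracted number has nonnegative mean by \<open>rate_le\<close>, so only
        the positive part needs an upper bound.\<close>
      moreover have "\<bar>x - q\<bar> \<le> 2 * (max 0 (x - g) + k) - (x - q)" if "g \<le> q + k" "0 \<le> k" for x g q k :: real
        using that by (auto simp: abs_if max_def)
      ultimately show "\<bar>?D \<omega> - real m * t * rate u\<bar>
          \<le> 2 * (?P \<omega> + real m * (t * e)) - (?D \<omega> - real m * t * rate u)"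
        by blast
    qed (use iP in auto)
    also have "\<dots> = 2 * (expectation ?P + real m * (t * e)) - (\<gamma> (real m *\<^sub>R t *\<^sub>R u) - real m * t * rate u)"
      using iP by (simp add: prob_space expectation_D)
    also have "\<dots> \<le> 2 * (real m * (t * e) + real m * (t * e)) - 0"
      using elim(1) rate_le[OF mt, of u] mt
      by (intro diff_mono mult_left_mono add_right_mono) (auto simp: pos_le_divide_eq mult.commute)
    finally show ?case by (simp add: algebra_simps)
  qed
qed

text \<open>The point \<open>z\<close> is compared with the last multiple \<open>y\<close> of the
  step \<open>t u\<close> not beyond radius \<open>norm z\<close>. In the constant, 4 comes from the
  ray, one \<open>C\<close> from the mean distance between \<open>y\<close> and \<open>z\<close>,
  the other from the change of rate, and the remaining 1 absorbs the terms independent of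
  \<open>z\<close>.\<close>

lemma convergence_near_ray:
  assumes C: "C \<ge> 0" "\<And>z. \<gamma> z \<le> C * max 1 (norm z)"
    and u: "norm u = 1" and e: "e > 0"
  obtains R where "R > 0"
    "\<And>z. \<lbrakk>norm z \<ge> R; norm (z /\<^sub>R norm z - u) \<le> e\<rbrakk> \<Longrightarrow>
      expectation (\<lambda>\<omega>. \<bar>D 0 z \<omega> - norm z * rate (z /\<^sub>R norm z)\<bar>) \<le> (5 + 2 * C) * e * norm z"
proof -
  obtain t where t: "t > 0" "\<gamma> (t *\<^sub>R u) \<le> t * (rate u + e)" using rate_approx[OF e] by blast
  obtain m0 where m0: "\<And>m. m \<ge> m0 \<Longrightarrow>
     expectation (\<lambda>\<omega>. \<bar>D 0 (real m *\<^sub>R t *\<^sub>R u) \<omega> - real m * t * rate u\<bar>) \<le> 4 * e * (real m * t)"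
    using convergence_on_ray[OF u t(1) e t(2)] by (auto simp: eventually_sequentially)
  \<comment> \<open>The first summand forces \<open>m \<ge> m0\<close>; the second makes the terms
    independent of \<open>z\<close> at most \<open>e * norm z\<close>.\<close>
  define R where "R = t * (real m0 + 1) + (C * (1 + t) + t * rate u) / e"
  have "R > 0" using t e C by (auto simp: R_def intro!: add_pos_nonneg)
  moreover have "expectation (\<lambda>\<omega>. \<bar>D 0 z \<omega> - norm z * rate (z /\<^sub>R norm z)\<bar>) \<le> (5 + 2 * C) * e * norm z"
    if z: "norm z \<ge> R" "norm (z /\<^sub>R norm z - u) \<le> e" for z
  proof -
    define r where "r = norm z"
    define w where "w = z /\<^sub>R r"
    have r: "r > 0" "r \<ge> R" using z \<open>R > 0\<close> by (auto simp: r_def)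
    have zw: "z = r *\<^sub>R w" "norm (w - u) \<le> e" using r z by (auto simp: w_def r_def)
    define m where "m = nat \<lfloor>r / t\<rfloor>"
    have "r / t > real m0"
    proof -
      have "t * (real m0 + 1) \<le> R" using t e C by (simp add: R_def)
      then have "t * (real m0 + 1) \<le> r" using r by simp
      then show ?thesis using t by (simp add: field_simps)
    qed
    then have m: "m \<ge> m0" "real m \<le> r / t" "r / t \<le> real m + 1" unfolding m_def by linarith+
    have mt: "real m * t \<le> r" "r \<le> real m * t + t"
      using m t by (auto simp: field_simps)
    define y where "y = real m *\<^sub>R t *\<^sub>R u"
    have "z - y = r *\<^sub>R (w - u) + (r - real m * t) *\<^sub>R u"
      by (simp add: zw y_def algebra_simps)
    also have "norm \<dots> \<le> r * norm (w - u) + \<bar>r - real m * t\<bar> * norm u"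
      using r by (intro order_trans[OF norm_triangle_ineq]) simp
    also have "\<dots> \<le> r * e + t"
      using zw r mt u by (intro add_mono mult_left_mono) auto
    finally have zy: "norm (z - y) \<le> r * e + t" .
    have "max 1 (norm (z - y)) \<le> 1 + t + r * e" using zy t r e by simp
    then have \<gamma>zy: "\<gamma> (z - y) \<le> C * (1 + t + r * e)"
      using C by (meson mult_left_mono order_trans)
    have "\<bar>real m * t * rate u - r * rate w\<bar> \<le> \<bar>real m * t - r\<bar> * rate u + r * \<bar>rate u - rate w\<bar>"
    proof -
      have "real m * t * rate u - r * rate w = (real m * t - r) * rate u + r * (rate u - rate w)"
        by (simp add: algebra_simps)
      then show ?thesis using r by (simp add: abs_mult order_trans[OF abs_triangle_ineq])
    qed
    also have "\<dots> \<le> t * rate u + r * (C * e)"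
    proof (intro add_mono mult_right_mono mult_left_mono)
      show "\<bar>rate u - rate w\<bar> \<le> C * e"
        using rate_lipschitz[OF C, of u w] zw(2) C(1)
        by (metis mult_left_mono norm_minus_commute order_trans)
    qed (use mt r in auto)
    finally have rates: "\<bar>real m * t * rate u - r * rate w\<bar> \<le> t * rate u + r * (C * e)" .
    have "expectation (\<lambda>\<omega>. \<bar>D 0 z \<omega> - r * rate w\<bar>)
      \<le> expectation (\<lambda>\<omega>. D y z \<omega> + \<bar>D 0 y \<omega> - real m * t * rate u\<bar> + \<bar>real m * t * rate u - r * rate w\<bar>)"
    proof (rule integral_mono_AE)
      show "AE \<omega> in M. \<bar>D 0 z \<omega> - r * rate w\<bar>
        \<le> D y z \<omega> + \<bar>D 0 y \<omega> - real m * t * rate u\<bar> + \<bar>real m * t * rate u - r * rate w\<bar>"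
        using AE_occupied[of 0] AE_occupied[of y] AE_occupied[of z]
      proof eventually_elim
        case (elim \<omega>)
        have "\<bar>D 0 z \<omega> - D 0 y \<omega>\<bar> \<le> D y z \<omega>"
          using D_triangle[of 0 \<omega> y z] D_triangle[of 0 \<omega> z y] D_commute[of y \<omega> z] elim by linarith
        then show ?case by linarith
      qed
    qed auto
    also have "\<dots> = \<gamma> (z - y) + expectation (\<lambda>\<omega>. \<bar>D 0 y \<omega> - real m * t * rate u\<bar>) + \<bar>real m * t * rate u - r * rate w\<bar>"
      by (simp add: prob_space expectation_D)
    also have "\<dots> \<le> C * (1 + t + r * e) + 4 * e * r + (t * rate u + r * (C * e))"
    proof (intro add_mono \<gamma>zy rates)
      have "expectation (\<lambda>\<omega>. \<bar>D 0 y \<omega> - real m * t * rate u\<bar>) \<le> 4 * e * (real m * t)"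
        unfolding y_def by (rule m0[OF m(1)])
      also have "\<dots> \<le> 4 * e * r" using mt e by (intro mult_left_mono) auto
      finally show "expectation (\<lambda>\<omega>. \<bar>D 0 y \<omega> - real m * t * rate u\<bar>) \<le> 4 * e * r" .
    qed
    also have "\<dots> = (C * (1 + t) + t * rate u) + (4 + 2 * C) * e * r" by (simp add: algebra_simps)
    also have "C * (1 + t) + t * rate u \<le> e * r"
    proof -
      have "(C * (1 + t) + t * rate u) / e \<le> R" using t by (simp add: R_def)
      then have "(C * (1 + t) + t * rate u) / e \<le> r" using r by simp
      then show ?thesis using e by (simp add: field_simps)
    qed
    finally show ?thesis by (simp add: r_def w_def algebra_simps)
  qed
  ultimately show ?thesis using that by blast
qed

lemma convergence_uniform:
  assumes e: "e > 0"
  obtains R where "R > 0"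
    "\<And>z. norm z \<ge> R \<Longrightarrow>
      expectation (\<lambda>\<omega>. \<bar>D 0 z \<omega> - norm z * rate (z /\<^sub>R norm z)\<bar>) \<le> e * norm z"
proof -
  obtain C where C: "C \<ge> 0" "\<And>z. \<gamma> z \<le> C * max 1 (norm z)" by (rule \<gamma>_bound) blast
  define \<delta> where "\<delta> = e / (5 + 2 * C)"
  have \<delta>: "\<delta> > 0" "(5 + 2 * C) * \<delta> = e" using e C by (auto simp: \<delta>_def)
  obtain k where k: "finite k" "k \<subseteq> sphere (0::plane) 1" "sphere 0 1 \<subseteq> (\<Union>x\<in>k. ball x \<delta>)"
    by (rule compactE_image[of "sphere 0 1" "sphere 0 1" "\<lambda>x::plane. ball x \<delta>"])
      (use \<delta>(1) in auto)
  have "\<forall>u\<in>k. \<exists>R>0. \<forall>z. norm z \<ge> R \<longrightarrow> norm (z /\<^sub>R norm z - u) \<le> \<delta> \<longrightarrow>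
      expectation (\<lambda>\<omega>. \<bar>D 0 z \<omega> - norm z * rate (z /\<^sub>R norm z)\<bar>) \<le> e * norm z"
  proof
    fix u assume "u \<in> k"
    then have "norm u = 1" using k by auto
    from convergence_near_ray[OF C this \<delta>(1)] obtain R where "R > 0"
      "\<And>z. \<lbrakk>norm z \<ge> R; norm (z /\<^sub>R norm z - u) \<le> \<delta>\<rbrakk> \<Longrightarrow>
        expectation (\<lambda>\<omega>. \<bar>D 0 z \<omega> - norm z * rate (z /\<^sub>R norm z)\<bar>) \<le> (5 + 2 * C) * \<delta> * norm z"
      by blast
    then show "\<exists>R>0. \<forall>z. norm z \<ge> R \<longrightarrow> norm (z /\<^sub>R norm z - u) \<le> \<delta> \<longrightarrow>
      expectation (\<lambda>\<omega>. \<bar>D 0 z \<omega> - norm z * rate (z /\<^sub>R norm z)\<bar>) \<le> e * norm z"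
      unfolding \<delta>(2) by blast
  qed
  then obtain R where "\<forall>u\<in>k. R u > 0 \<and> (\<forall>z. norm z \<ge> R u \<longrightarrow> norm (z /\<^sub>R norm z - u) \<le> \<delta> \<longrightarrow>
      expectation (\<lambda>\<omega>. \<bar>D 0 z \<omega> - norm z * rate (z /\<^sub>R norm z)\<bar>) \<le> e * norm z)"
    by (rule bchoice[THEN exE])
  then have R: "\<And>u. u \<in> k \<Longrightarrow> R u > 0"
    "\<And>u z. \<lbrakk>u \<in> k; norm z \<ge> R u; norm (z /\<^sub>R norm z - u) \<le> \<delta>\<rbrakk> \<Longrightarrow>
      expectation (\<lambda>\<omega>. \<bar>D 0 z \<omega> - norm z * rate (z /\<^sub>R norm z)\<bar>) \<le> e * norm z"
    by blast+
  \<comment> \<open>The sum of positive radii dominates each of them; the 1 gives positivity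
    directly.\<close>
  define R' where "R' = 1 + (\<Sum>u\<in>k. R u)"
  have "R' > 0" unfolding R'_def by (intro add_pos_nonneg sum_nonneg less_imp_le R(1)) auto
  moreover have "expectation (\<lambda>\<omega>. \<bar>D 0 z \<omega> - norm z * rate (z /\<^sub>R norm z)\<bar>) \<le> e * norm z"
    if z: "norm z \<ge> R'" for z
  proof -
    have "norm z > 0" using z \<open>R' > 0\<close> by linarith
    then have "z /\<^sub>R norm z \<in> sphere 0 1" by simp
    then have "z /\<^sub>R norm z \<in> (\<Union>x\<in>k. ball x \<delta>)" using k(3) by (rule subsetD[rotated])
    then obtain u where u: "u \<in> k" "dist u (z /\<^sub>R norm z) < \<delta>" unfolding UN_iff mem_ball by blast
    have "R u \<le> (\<Sum>u\<in>k. R u)" using u k(1) by (intro member_le_sum less_imp_le R(1)) auto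
    then show ?thesis using z u by (intro R(2)[of u]) (auto simp: R'_def dist_norm norm_minus_commute)
  qed
  ultimately show ?thesis using that by blast
qed

end

section \<open>Sums of deviations\<close>

text \<open>From \<open>k / 4 \<le> exp (k / 4)\<close> follows
  \<open>k ^ 4 \<le> 256 * exp 1 ^ k\<close>, which turns the series into an exponential series at
  \<open>a * exp 1\<close>. Fourth moments are what AM-GM demands for the squared counts in
  \<open>deviation_sum_le\<close>.\<close>

lemma summable_poisson_fourth_moment:
  fixes a :: real
  assumes "a \<ge> 0"
  shows "summable (\<lambda>k. real k ^ 4 * (exp (- a) * a ^ k / fact k))"
proof (rule summable_comparison_test')
  show "summable (\<lambda>k. 256 * exp (- a) * ((a * exp 1) ^ k /\<^sub>R fact k))"
    by (intro summable_mult summable_exp_generic)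
  fix k :: nat
  have "real k / 4 \<le> exp (real k / 4)"
    using exp_ge_add_one_self[of "real k / 4"] by linarith
  then have "(real k / 4) ^ 4 \<le> exp (real k / 4) ^ 4"
    by (intro power_mono) auto
  also have "\<dots> = exp 1 ^ k"
    by (simp flip: exp_of_nat_mult)
  finally have "real k ^ 4 \<le> 256 * exp 1 ^ k" by (simp add: power_divide)
  then have "real k ^ 4 * (exp (- a) * a ^ k / fact k) \<le> 256 * exp 1 ^ k * (exp (- a) * a ^ k / fact k)"
    using assms by (intro mult_right_mono) auto
  then show "norm (real k ^ 4 * (exp (- a) * a ^ k / fact k)) \<le> 256 * exp (- a) * ((a * exp 1) ^ k /\<^sub>R fact k)"
    using assms by (simp add: power_mult_distrib field_simps)
qed

lemma at_infinity_bound_imp_tendsto_0: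
  fixes f :: "plane \<Rightarrow> ennreal"
  assumes "\<And>e. e > 0 \<Longrightarrow> \<exists>R. \<forall>z. norm z \<ge> R \<longrightarrow> f z \<le> ennreal e"
  shows "(f \<longlongrightarrow> 0) at_infinity"
proof (rule order_tendstoI)
  fix a :: ennreal assume "0 < a"
  then obtain b where b: "0 < b" "b < a" using dense by blast
  then obtain e where e: "e > 0" "ennreal e < a" by (cases b) auto
  obtain R where "\<forall>z. norm z \<ge> R \<longrightarrow> f z \<le> ennreal e" using assms e by blast
  then show "\<forall>\<^sub>F z in at_infinity. f z < a"
    using e by (auto simp: eventually_at_infinity intro: le_less_trans)
qed simp

text \<open>Shaped after the bound in \<open>deviation_sum_le\<close>, which
  \<open>deviation_bound\<close> moves between \<open>real\<close> and \<open>ennreal\<close> twice: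
  pointwise and after integration.\<close>

lemma ennreal_add_mult:
  assumes "0 \<le> a" "0 \<le> b" "0 \<le> c" "0 \<le> x" "0 \<le> y" "0 \<le> t" "0 \<le> g"
  shows "ennreal (a * (x + y) + (b * t + c * g))
    = ennreal a * (ennreal x + ennreal y) + (ennreal b * ennreal t + ennreal c * ennreal g)"
  using assms by (simp add: ennreal_plus ennreal_mult)

text \<open>The deterministic core, with \<open>G\<close> marking bad outcomes. There AM-GM is used
  at scale \<open>r / \<eta>\<close> on each deviation and at scale
  \<open>1 / \<eta>\<^sup>2\<close> on the squared counts that bound the number of pairs. When the
  squared distances have mean of order \<open>r\<^sup>2\<close>, every term is of mean order
  \<open>\<eta> * r\<close> except \<open>2 * r / \<eta> ^ 3\<close>, which is paid only on
  \<open>G\<close>. The factor \<open>4 + 2 * C\<^sup>2\<close> adds 3 from the good case to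
  \<open>1 + 2 * C\<^sup>2\<close> from the bad one.\<close>

lemma deviation_sum_le:
  fixes \<eta> r c :: real
  assumes "finite (X \<inter> A)" "finite (X \<inter> B)" and pos: "\<eta> > 0" "r > 0"
    and G: "\<not> G \<Longrightarrow> (\<And>\<xi> \<xi>'. \<lbrakk>\<xi> \<in> X \<inter> A; \<xi>' \<in> X \<inter> B\<rbrakk> \<Longrightarrow> \<bar>\<delta> \<xi> \<xi>' - c\<bar> \<le> 3 * \<eta> * r)"
    and c: "\<bar>c\<bar> \<le> r * C"
  shows "deviation_sum X \<delta> A B c
    \<le> r * \<eta> * (4 + 2 * C\<^sup>2) * (real (card (X \<inter> A)) ^ 4 + real (card (X \<inter> B)) ^ 4)
      + 2 * \<eta> / r * (\<Sum>\<xi>\<in>X \<inter> A. \<Sum>\<xi>'\<in>X \<inter> B. (\<delta> \<xi> \<xi>')\<^sup>2) + 2 * r / \<eta> ^ 3 * of_bool G"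
proof -
  define m where "m = real (card (X \<inter> A))"
  define n where "n = real (card (X \<inter> B))"
  define Q where "Q = m ^ 4 + n ^ 4"
  define T where "T = (\<Sum>\<xi>\<in>X \<inter> A. \<Sum>\<xi>'\<in>X \<inter> B. (\<delta> \<xi> \<xi>')\<^sup>2)"
  have T: "T \<ge> 0" unfolding T_def by (intro sum_nonneg) auto
  have Q0: "Q \<ge> 0" by (simp add: Q_def)
  have sum_const: "(\<Sum>\<xi>\<in>X \<inter> A. \<Sum>\<xi>'\<in>X \<inter> B. k) = k * (m * n)" for k :: real
    by (simp add: m_def n_def)
  have mn: "2 * (m * n) \<le> m\<^sup>2 + n\<^sup>2"
    using zero_le_power2[of "m - n"] by (simp add: power2_eq_square algebra_simps)
  \<comment> \<open>Counts are integers; the inequality fails for reals strictly between 0 and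
    1.\<close>
  have sq: "x\<^sup>2 \<le> x ^ 4" if "x = real k" for x k
    using that by (cases "k = 0") (auto intro!: power_increasing)
  have mnQ: "m * n \<le> Q"
    using mn sq[of m] sq[of n] zero_le_power2[of m] zero_le_power2[of n] unfolding m_def n_def Q_def
    by (smt (verit))
  show ?thesis
  proof (cases G)
    case False
    have "deviation_sum X \<delta> A B c \<le> (\<Sum>\<xi>\<in>X \<inter> A. \<Sum>\<xi>'\<in>X \<inter> B. 3 * \<eta> * r)"
      unfolding deviation_sum_def using G[OF False] by (intro sum_mono) auto
    also have "\<dots> \<le> 3 * \<eta> * r * Q"
      unfolding sum_const using mnQ pos by (intro mult_left_mono) auto
    also have "\<dots> \<le> (4 + 2 * C\<^sup>2) * \<eta> * r * Q"
      using pos Q0 by (intro mult_right_mono) auto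
    also have "\<dots> = r * \<eta> * (4 + 2 * C\<^sup>2) * Q" by simp
    finally have "deviation_sum X \<delta> A B c \<le> r * \<eta> * (4 + 2 * C\<^sup>2) * Q" .
    moreover have "0 \<le> 2 * \<eta> / r * T" using pos T by simp
    ultimately show ?thesis
      unfolding m_def[symmetric] n_def[symmetric] Q_def[symmetric] T_def[symmetric] using False by simp
  next
    case True
    have "\<bar>x - c\<bar> \<le> 2 * \<eta> / r * x\<^sup>2 + (2 * \<eta> * r * C\<^sup>2 + r / \<eta>)" for x
    proof -
      have "\<bar>x - c\<bar> \<le> \<bar>x - c\<bar>\<^sup>2 * (1 / (r / \<eta>)) + r / \<eta>"
        using pos by (intro real_le_square_add) simp
      also have "\<dots> = \<eta> / r * (x - c)\<^sup>2 + r / \<eta>" by simp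
      also have "\<eta> / r * (x - c)\<^sup>2 \<le> \<eta> / r * (2 * x\<^sup>2 + 2 * (r * C)\<^sup>2)"
      proof (rule mult_left_mono)
        have "(x - c)\<^sup>2 \<le> 2 * x\<^sup>2 + 2 * c\<^sup>2"
          using zero_le_power2[of "x + c"] by (simp add: power2_eq_square algebra_simps)
        moreover have "c\<^sup>2 \<le> (r * C)\<^sup>2" using c by (metis abs_le_square_iff abs_ge_self order_trans)
        ultimately show "(x - c)\<^sup>2 \<le> 2 * x\<^sup>2 + 2 * (r * C)\<^sup>2" by linarith
      qed (use pos in simp)
      also have "\<eta> / r * (2 * x\<^sup>2 + 2 * (r * C)\<^sup>2) + r / \<eta> = 2 * \<eta> / r * x\<^sup>2 + (2 * \<eta> * r * C\<^sup>2 + r / \<eta>)"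
        using pos by (simp add: power2_eq_square field_simps)
      finally show ?thesis by simp
    qed
    then have "deviation_sum X \<delta> A B c
      \<le> (\<Sum>\<xi>\<in>X \<inter> A. \<Sum>\<xi>'\<in>X \<inter> B. 2 * \<eta> / r * (\<delta> \<xi> \<xi>')\<^sup>2 + (2 * \<eta> * r * C\<^sup>2 + r / \<eta>))"
      unfolding deviation_sum_def by (intro sum_mono) auto
    also have "\<dots> = 2 * \<eta> / r * T + 2 * \<eta> * r * C\<^sup>2 * (m * n) + r / \<eta> * (m * n)"
      unfolding sum.distrib sum_const T_def by (simp only: sum_distrib_left distrib_right add.assoc)
    also have "\<dots> \<le> 2 * \<eta> / r * T + 2 * \<eta> * r * C\<^sup>2 * Q + r / \<eta> * (\<eta>\<^sup>2 * Q + 2 / \<eta>\<^sup>2)"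
    proof (intro add_mono mult_left_mono mnQ)
      have *: "x\<^sup>2 \<le> \<eta>\<^sup>2 * x ^ 4 + 1 / \<eta>\<^sup>2" for x :: real
      proof -
        have "x\<^sup>2 \<le> (x\<^sup>2)\<^sup>2 * (1 / (1 / \<eta>\<^sup>2)) + 1 / \<eta>\<^sup>2"
          using pos by (intro real_le_square_add) simp
        also have "(x\<^sup>2)\<^sup>2 * (1 / (1 / \<eta>\<^sup>2)) = \<eta>\<^sup>2 * x ^ 4" by simp
        finally show ?thesis .
      qed
      have "m * n \<le> m\<^sup>2 + n\<^sup>2" using mn zero_le_power2[of m] zero_le_power2[of n] by linarith
      also have "\<dots> \<le> (\<eta>\<^sup>2 * m ^ 4 + 1 / \<eta>\<^sup>2) + (\<eta>\<^sup>2 * n ^ 4 + 1 / \<eta>\<^sup>2)"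
        by (intro add_mono *)
      also have "\<dots> = \<eta>\<^sup>2 * Q + 2 / \<eta>\<^sup>2" by (simp add: Q_def algebra_simps)
      finally show "m * n \<le> \<eta>\<^sup>2 * Q + 2 / \<eta>\<^sup>2" .
    qed (use pos in auto)
    also have "r / \<eta> * (\<eta>\<^sup>2 * Q + 2 / \<eta>\<^sup>2) = r * \<eta> * Q + 2 * r / \<eta> ^ 3"
      using pos by (simp add: power2_eq_square power3_eq_cube field_simps)
    also have "2 * \<eta> / r * T + 2 * \<eta> * r * C\<^sup>2 * Q + (r * \<eta> * Q + 2 * r / \<eta> ^ 3)
      \<le> r * \<eta> * (4 + 2 * C\<^sup>2) * Q + 2 * \<eta> / r * T + 2 * r / \<eta> ^ 3"
    proof -
      have "0 \<le> 3 * (r * \<eta> * Q)" using pos Q0 by simp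
      then show ?thesis by (simp add: algebra_simps)
    qed
    finally show ?thesis using True by (simp add: m_def n_def Q_def T_def)
  qed
qed

context poisson_metric
begin

lemma card_measurable:
  assumes "A \<in> sets borel" "bounded A"
  shows "(\<lambda>\<omega>. card (\<Xi> \<omega> \<inter> A)) \<in> measurable M (count_space UNIV)"
  using assms poisson by (auto simp: unit_poisson_process_def)

lemma card_fourth_moment:
  assumes "A \<in> sets borel" "bounded A"
  obtains K where "K \<ge> 0"
    "\<And>z. (\<integral>\<^sup>+ \<omega>. ennreal (real (card (\<Xi> \<omega> \<inter> (+) z ` A)) ^ 4) \<partial>M) \<le> ennreal K"
proof -
  define a where "a = measure lborel A"
  let ?p = "\<lambda>k. real k ^ 4 * (exp (- a) * a ^ k / fact k)"
  have a: "a \<ge> 0" by (simp add: a_def)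
  have p0: "?p k \<ge> 0" for k using a by simp
  have "(\<integral>\<^sup>+ \<omega>. ennreal (real (card (\<Xi> \<omega> \<inter> (+) z ` A)) ^ 4) \<partial>M) \<le> ennreal (suminf ?p)" for z
  proof -
    let ?N = "\<lambda>\<omega>. card (\<Xi> \<omega> \<inter> (+) z ` A)"
    have A: "(+) z ` A \<in> sets borel" "bounded ((+) z ` A)"
      using assms by (auto intro: borel_image_plus bounded_translation)
    \<comment> \<open>\<open>measure_translation\<close> concerns Lebesgue measure, the completion
      of \<open>lborel\<close>; the two agree on Borel sets.\<close>
    have meas: "measure lborel ((+) z ` A) = a"
      using A(1) assms(1) measure_translation[of z A] by (simp add: a_def measure_completion)
    have ev [measurable]: "{\<omega> \<in> space M. ?N \<omega> = k} \<in> events" for k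
      using prob_card_points(1)[OF A] .
    have "(\<integral>\<^sup>+ \<omega>. ennreal (real (?N \<omega>) ^ 4) \<partial>M)
      \<le> (\<integral>\<^sup>+ \<omega>. (\<Sum>k. ennreal (real k ^ 4) * indicator {\<omega> \<in> space M. ?N \<omega> = k} \<omega>) \<partial>M)"
    proof (rule nn_integral_mono)
      fix \<omega> assume "\<omega> \<in> space M"
      then show "ennreal (real (?N \<omega>) ^ 4)
         \<le> (\<Sum>k. ennreal (real k ^ 4) * indicator {\<omega> \<in> space M. ?N \<omega> = k} \<omega>)"
        using sum_le_suminf[of "\<lambda>k. ennreal (real k ^ 4) * indicator {\<omega> \<in> space M. ?N \<omega> = k} \<omega>" "{?N \<omega>}"]
        by simp
    qed
    also have "\<dots> = (\<Sum>k. \<integral>\<^sup>+ \<omega>. ennreal (real k ^ 4) * indicator {\<omega> \<in> space M. ?N \<omega> = k} \<omega> \<partial>M)"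
      by (intro nn_integral_suminf) measurable
    also have "\<dots> = (\<Sum>k. ennreal (?p k))"
    proof (intro suminf_cong)
      fix k
      have "(\<integral>\<^sup>+ \<omega>. ennreal (real k ^ 4) * indicator {\<omega> \<in> space M. ?N \<omega> = k} \<omega> \<partial>M)
        = ennreal (real k ^ 4) * emeasure M {\<omega> \<in> space M. ?N \<omega> = k}"
        by (rule nn_integral_cmult_indicator) measurable
      also have "\<dots> = ennreal (?p k)"
        using prob_card_points(2)[OF A, of k] a by (simp add: emeasure_eq_measure meas flip: ennreal_mult)
      finally show "(\<integral>\<^sup>+ \<omega>. ennreal (real k ^ 4) * indicator {\<omega> \<in> space M. ?N \<omega> = k} \<omega> \<partial>M) = ennreal (?p k)" .
    qed
    also have "\<dots> = ennreal (suminf ?p)"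
      using summable_poisson_fourth_moment[OF a] p0 by (intro suminf_ennreal2) auto
    finally show ?thesis .
  qed
  moreover have "suminf ?p \<ge> 0" using summable_poisson_fourth_moment[OF a] p0 by (intro suminf_nonneg) auto
  ultimately show ?thesis using that by blast
qed

lemma point_dist_realization_measurable:
  assumes "A \<in> sets borel" "bounded A"
  shows "(\<lambda>\<omega>. point_dist A x (realization \<omega>)) \<in> borel_measurable M"
  using point_dist_measurable[OF assms] by (rule measurable_compose[OF realization_measurable])

text \<open>By stationarity the replacement error at the far end has a law independent of
  \<open>z\<close>, so one tail bound serves all positions.\<close>

lemma point_dist_shift:
  assumes "A \<in> sets borel" "bounded A"
  shows "prob {\<omega> \<in> space M. point_dist ((+) z ` A) z (realization \<omega>) > c}
    = prob {\<omega> \<in> space M. point_dist A 0 (realization \<omega>) > c}"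
proof -
  have A: "(+) z ` A \<in> sets borel" "bounded ((+) z ` A)"
    using assms by (auto intro: borel_image_plus bounded_translation)
  note [measurable] = point_dist_measurable[OF A] point_dist_measurable[OF assms]
  have eq: "point_dist ((+) z ` A) z (translate z s) = point_dist A 0 s" for s
    unfolding point_dist_translate image_image by simp
  let ?S = "{s \<in> space config_space. point_dist ((+) z ` A) z s > c}"
  have S [measurable]: "?S \<in> sets config_space" by measurable
  have "(\<integral>\<^sup>+ \<omega>. indicator ?S (realization \<omega>) \<partial>M) = (\<integral>\<^sup>+ \<omega>. indicator ?S (translate z (realization \<omega>)) \<partial>M)"
    by (rule nn_integral_translate[symmetric]) measurable
  moreover have "(\<integral>\<^sup>+ \<omega>. indicator ?S (realization \<omega>) \<partial>M)
      = (\<integral>\<^sup>+ \<omega>. indicator {\<omega> \<in> space M. point_dist ((+) z ` A) z (realization \<omega>) > c} \<omega> \<partial>M)"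
    using realization_configs by (intro nn_integral_cong) (auto simp: indicator_def)
  moreover have "(\<integral>\<^sup>+ \<omega>. indicator ?S (translate z (realization \<omega>)) \<partial>M)
      = (\<integral>\<^sup>+ \<omega>. indicator {\<omega> \<in> space M. point_dist A 0 (realization \<omega>) > c} \<omega> \<partial>M)"
    using realization_configs translate_in_configs
    by (intro nn_integral_cong) (auto simp: indicator_def eq)
  ultimately show ?thesis by (simp add: emeasure_eq_measure)
qed

lemma point_dist_finite:
  assumes "\<omega> \<in> space M" "bounded A"
  shows "point_dist A x (realization \<omega>) < \<infinity>"
  unfolding point_dist_def using assms by (intro sup_dist_finite) auto

text \<open>Tightness of a finite random variable: the tail events decrease to the empty
  set.\<close>

lemma point_dist_tail:
  assumes A: "A \<in> sets borel" "bounded A" and e: "e > 0"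
  obtains R :: real where
    "\<And>r. r \<ge> R \<Longrightarrow> prob {\<omega> \<in> space M. point_dist A 0 (realization \<omega>) > ennreal r} \<le> e"
proof -
  note [measurable] = point_dist_realization_measurable[OF A]
  define T where "T r = {\<omega> \<in> space M. point_dist A 0 (realization \<omega>) > ennreal r}" for r :: real
  have T [measurable]: "T r \<in> events" for r unfolding T_def by measurable
  have "(\<lambda>n. prob (T (real n))) \<longlonglongrightarrow> prob (\<Inter>n. T (real n))"
  proof (rule finite_Lim_measure_decseq)
    show "decseq (\<lambda>n. T (real n))"
      unfolding decseq_def T_def by (auto elim!: le_less_trans[rotated] intro!: ennreal_leI)
  qed auto
  moreover have "(\<Inter>n. T (real n)) = {}"
  proof (rule ccontr)
    assume "(\<Inter>n. T (real n)) \<noteq> {}"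
    then obtain \<omega> where \<omega>: "\<And>n. \<omega> \<in> T (real n)" by auto
    then have "point_dist A 0 (realization \<omega>) < \<infinity>" using A by (intro point_dist_finite) (auto simp: T_def)
    then obtain q where q: "q \<ge> 0" "point_dist A 0 (realization \<omega>) = ennreal q"
      by (cases "point_dist A 0 (realization \<omega>)") auto
    obtain n :: nat where "q \<le> real n" using real_arch_simple by blast
    then show False using \<omega>[of n] q by (simp add: T_def ennreal_less_iff)
  qed
  ultimately have "(\<lambda>n. prob (T (real n))) \<longlonglongrightarrow> 0" by simp
  then have "\<forall>\<^sub>F n in sequentially. prob (T (real n)) < e" using e by (intro order_tendstoD(2)) auto
  then obtain n where n: "prob (T (real n)) < e" by (auto simp: eventually_sequentially)
  have "prob (T r) \<le> e" if "r \<ge> real n" for r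
  proof -
    have "prob (T r) \<le> prob (T (real n))"
      using that unfolding T_def
      by (intro finite_measure_mono) (auto elim!: le_less_trans[rotated] intro!: ennreal_leI T[unfolded T_def])
    then show ?thesis using n by simp
  qed
  then show ?thesis using that unfolding T_def by blast
qed

text \<open>Let \<open>\<eta>\<close>, \<open>\<eta>'\<close> attain \<open>D x y\<close>. Each of
  the two distances is at most the other plus the legs from \<open>\<xi>\<close> to
  \<open>\<eta>\<close> and from \<open>\<xi>'\<close> to \<open>\<eta>'\<close>, and each leg is at
  most \<open>q\<close>.\<close>

lemma d_near_D:
  assumes occ: "occupied x \<omega>" "occupied y \<omega>"
    and \<xi>: "\<xi> \<in> \<Xi> \<omega> \<inter> A" "\<xi>' \<in> \<Xi> \<omega> \<inter> B"
    and q: "point_dist A x (realization \<omega>) \<le> ennreal q" "point_dist B y (realization \<omega>) \<le> ennreal q" "q \<ge> 0"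
  shows "\<bar>d \<omega> \<xi> \<xi>' - D x y \<omega>\<bar> \<le> 2 * q"
proof -
  have \<omega>: "\<omega> \<in> space M" using occ by (simp add: occupied_def)
  obtain \<eta> \<eta>' where \<eta>: "\<eta> \<in> \<Xi> \<omega> \<inter> home x (realization \<omega>)" "\<eta>' \<in> \<Xi> \<omega> \<inter> home y (realization \<omega>)"
    "D x y \<omega> = d \<omega> \<eta> \<eta>'" using D_attained[OF occ] by blast
  have "d \<omega> \<xi> \<eta> \<le> q"
    using order_trans[OF sup_dist_ge[OF \<xi>(1) \<eta>(1)] q(1)[unfolded point_dist_def]] q(3) by simp
  moreover have "d \<omega> \<xi>' \<eta>' \<le> q"
    using order_trans[OF sup_dist_ge[OF \<xi>(2) \<eta>(2)] q(2)[unfolded point_dist_def]] q(3) by simp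
  moreover have "d \<omega> \<xi> \<xi>' \<le> d \<omega> \<xi> \<eta> + (d \<omega> \<eta> \<eta>' + d \<omega> \<eta>' \<xi>')"
    using triangle[OF \<omega>, of \<xi> \<eta> \<xi>'] triangle[OF \<omega>, of \<eta> \<eta>' \<xi>'] \<xi> \<eta> by simp
  moreover have "d \<omega> \<eta> \<eta>' \<le> d \<omega> \<eta> \<xi> + (d \<omega> \<xi> \<xi>' + d \<omega> \<xi>' \<eta>')"
    using triangle[OF \<omega>, of \<eta> \<xi> \<eta>'] triangle[OF \<omega>, of \<xi> \<xi>' \<eta>'] \<xi> \<eta> by simp
  ultimately show ?thesis
    using symm[OF \<omega>, of \<xi> \<eta>] symm[OF \<omega>, of \<xi>' \<eta>'] \<xi> \<eta> by simp
qed

lemma deviation_bound: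
  assumes A: "A \<in> sets borel" "bounded A" and B: "B \<in> sets borel" "bounded B" and e: "e > 0"
  shows "\<exists>R. \<forall>z. norm z \<ge> R \<longrightarrow>
    (\<integral>\<^sup>+ \<omega>. ennreal (deviation_sum (\<Xi> \<omega>) (d \<omega>) A ((+) z ` B) (norm z * rate (z /\<^sub>R norm z))) \<partial>M)
      / ennreal (norm z) \<le> ennreal e"
proof -
  obtain C where C: "C \<ge> 0" "\<And>z. \<gamma> z \<le> C * max 1 (norm z)" by (rule \<gamma>_bound) blast
  obtain K where K: "K \<ge> 0"
    "\<And>z. (\<integral>\<^sup>+ \<omega>. pair_sum (\<lambda>x. ennreal (x\<^sup>2)) A ((+) z ` B) (realization \<omega>) \<partial>M)
        \<le> ennreal (K * (max 1 (norm z))\<^sup>2)"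
    using second_moment_bound[OF A B] by blast
  obtain m1 where m1: "m1 \<ge> 0"
    "\<And>z. (\<integral>\<^sup>+ \<omega>. ennreal (real (card (\<Xi> \<omega> \<inter> (+) z ` A)) ^ 4) \<partial>M) \<le> ennreal m1"
    using card_fourth_moment[OF A] by blast
  obtain m2 where m2: "m2 \<ge> 0"
    "\<And>z. (\<integral>\<^sup>+ \<omega>. ennreal (real (card (\<Xi> \<omega> \<inter> (+) z ` B)) ^ 4) \<partial>M) \<le> ennreal m2"
    using card_fourth_moment[OF B] by blast
  define \<kappa> where "\<kappa> = (4 + 2 * C\<^sup>2) * (m1 + m2) + 2 * K"
  have \<kappa>: "\<kappa> \<ge> 0" using m1 m2 K by (auto simp: \<kappa>_def intro!: add_nonneg_nonneg mult_nonneg_nonneg)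
  \<comment> \<open>\<open>\<kappa>\<close> collects the coefficients of \<open>\<eta> * r\<close>
    in the integrated bound, and \<open>\<eta>\<close> makes their share at most
    \<open>e / 2\<close>; the 1 covers \<open>\<kappa> = 0\<close>.\<close>
  define \<eta> where "\<eta> = e / (2 * (\<kappa> + 1))"
  have \<eta>: "\<eta> > 0" using e \<kappa> by (simp add: \<eta>_def)
  have \<eta>\<kappa>: "\<eta> * \<kappa> \<le> e / 2"
  proof -
    have "\<eta> * \<kappa> \<le> \<eta> * (\<kappa> + 1)" using \<eta> by simp
    also have "\<dots> = e / 2" using \<kappa> by (simp add: \<eta>_def field_simps)
    finally show ?thesis .
  qed
  \<comment> \<open>Chosen so that \<open>2 / \<eta> ^ 3 * (3 * p) = e / 2\<close>, the share of the
    three bad events.\<close>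
  define p where "p = \<eta> ^ 3 * e / 12"
  have p: "p > 0" using \<eta> e by (simp add: p_def)
  \<comment> \<open>The extra factor \<open>\<eta>\<close> is consumed by Markov's inequality at
    threshold \<open>\<eta> * r\<close>, which leaves probability \<open>p\<close>.\<close>
  obtain R1 where R1: "R1 > 0" "\<And>z. norm z \<ge> R1 \<Longrightarrow>
      expectation (\<lambda>\<omega>. \<bar>D 0 z \<omega> - norm z * rate (z /\<^sub>R norm z)\<bar>) \<le> (p * \<eta>) * norm z"
    using convergence_uniform[of "p * \<eta>"] p \<eta> by (metis mult_pos_pos)
  obtain R2 :: real where R2:
    "\<And>r. r \<ge> R2 \<Longrightarrow> prob {\<omega> \<in> space M. point_dist A 0 (realization \<omega>) > ennreal r} \<le> p"
    using point_dist_tail[OF A p] by blast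
  obtain R3 :: real where R3:
    "\<And>r. r \<ge> R3 \<Longrightarrow> prob {\<omega> \<in> space M. point_dist B 0 (realization \<omega>) > ennreal r} \<le> p"
    using point_dist_tail[OF B p] by blast
  \<comment> \<open>The quotients by \<open>\<eta>\<close> arise because the end errors are tested
    at threshold \<open>\<eta> * r\<close>; the 1 gives \<open>max 1 (norm z) = norm z\<close> in
    the moment bound.\<close>
  define R where "R = Max {1, R1, R2 / \<eta>, R3 / \<eta>}"
  have "(\<integral>\<^sup>+ \<omega>. ennreal (deviation_sum (\<Xi> \<omega>) (d \<omega>) A ((+) z ` B) (norm z * rate (z /\<^sub>R norm z))) \<partial>M)
      / ennreal (norm z) \<le> ennreal e" if z: "norm z \<ge> R" for z
  proof -
    define r where "r = norm z"
    define c where "c = r * rate (z /\<^sub>R r)"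
    have r: "r \<ge> 1" "r \<ge> R1" "\<eta> * r \<ge> R2" "\<eta> * r \<ge> R3"
      using z \<eta> by (simp_all add: R_def r_def pos_divide_le_eq mult.commute)
    have r0: "r > 0" "z \<noteq> 0" using r by (auto simp: r_def)
    have c: "\<bar>c\<bar> \<le> r * C"
    proof -
      have "rate (z /\<^sub>R r) \<le> \<gamma> (1 *\<^sub>R (z /\<^sub>R r)) / 1" by (rule rate_le) simp
      also have "\<dots> \<le> C" using C(2)[of "z /\<^sub>R r"] r0 by (simp add: r_def)
      finally show ?thesis using r0 by (simp add: c_def abs_mult)
    qed
    let ?B = "(+) z ` B"
    have zB: "?B \<in> sets borel" "bounded ?B" using B by (auto intro: borel_image_plus bounded_translation)
    note [measurable] = point_dist_realization_measurable[OF A] point_dist_realization_measurable[OF zB]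
      card_measurable[OF A] card_measurable[OF zB]
    have [measurable]: "(\<lambda>\<omega>. pair_sum (\<lambda>x. ennreal (x\<^sup>2)) A ?B (realization \<omega>)) \<in> borel_measurable M"
      by (rule measurable_compose[OF realization_measurable]) (intro pair_sum_measurable A zB, measurable)
    define G1 where "G1 = {\<omega> \<in> space M. \<bar>D 0 z \<omega> - c\<bar> \<ge> \<eta> * r}"
    define G2 where "G2 = {\<omega> \<in> space M. point_dist A 0 (realization \<omega>) > ennreal (\<eta> * r)}"
    define G3 where "G3 = {\<omega> \<in> space M. point_dist ?B z (realization \<omega>) > ennreal (\<eta> * r)}"
    define G where "G = G1 \<union> G2 \<union> G3"
    have G_ev [measurable]: "G1 \<in> events" "G2 \<in> events" "G3 \<in> events" "G \<in> events"
      unfolding G_def G1_def G2_def G3_def by measurable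
    have "prob G1 \<le> expectation (\<lambda>\<omega>. \<bar>D 0 z \<omega> - c\<bar>) / (\<eta> * r)"
      unfolding G1_def using \<eta> r0 by (intro integral_Markov_inequality_measure[where A = "{}"]) auto
    also have "\<dots> \<le> p"
      using R1(2)[of z] r \<eta> r0 by (simp add: c_def r_def pos_divide_le_eq mult_ac)
    finally have "prob G1 \<le> p" .
    moreover have "prob G2 \<le> p" unfolding G2_def using r by (intro R2) 
    moreover have "prob G3 \<le> p" unfolding G3_def point_dist_shift[OF B] using r by (intro R3)
    moreover have "prob G \<le> prob G1 + prob G2 + prob G3"
      unfolding G_def by (intro order_trans[OF measure_Un_le] add_mono) auto
    ultimately have pG: "prob G \<le> 3 * p" by simp
    let ?F = "\<lambda>\<omega>. ennreal (r * \<eta> * (4 + 2 * C\<^sup>2)) * (ennreal (real (card (\<Xi> \<omega> \<inter> A)) ^ 4) + ennreal (real (card (\<Xi> \<omega> \<inter> ?B)) ^ 4))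
      + (ennreal (2 * \<eta> / r) * pair_sum (\<lambda>x. ennreal (x\<^sup>2)) A ?B (realization \<omega>) + ennreal (2 * r / \<eta> ^ 3) * indicator G \<omega>)"
    have "(\<integral>\<^sup>+ \<omega>. ennreal (deviation_sum (\<Xi> \<omega>) (d \<omega>) A ?B c) \<partial>M) \<le> (\<integral>\<^sup>+ \<omega>. ?F \<omega> \<partial>M)"
    proof (rule nn_integral_mono_AE)
      show "AE \<omega> in M. ennreal (deviation_sum (\<Xi> \<omega>) (d \<omega>) A ?B c) \<le> ?F \<omega>"
        using AE_occupied[of 0] AE_occupied[of z] AE_space
      proof eventually_elim
        case (elim \<omega>)
        have near: "\<bar>d \<omega> \<xi> \<xi>' - c\<bar> \<le> 3 * \<eta> * r"
          if "\<not> \<omega> \<in> G" "\<xi> \<in> \<Xi> \<omega> \<inter> A" "\<xi>' \<in> \<Xi> \<omega> \<inter> ?B" for \<xi> \<xi>'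
        proof -
          have "\<bar>D 0 z \<omega> - c\<bar> \<le> \<eta> * r" "point_dist A 0 (realization \<omega>) \<le> ennreal (\<eta> * r)"
            "point_dist ?B z (realization \<omega>) \<le> ennreal (\<eta> * r)"
            using that(1) elim by (auto simp: G_def G1_def G2_def G3_def not_le not_less)
          moreover from this have "\<bar>d \<omega> \<xi> \<xi>' - D 0 z \<omega>\<bar> \<le> 2 * (\<eta> * r)"
            using elim that \<eta> r0 by (intro d_near_D) auto
          ultimately show ?thesis by linarith
        qed
        let ?T = "\<Sum>\<xi>\<in>\<Xi> \<omega> \<inter> A. \<Sum>\<xi>'\<in>\<Xi> \<omega> \<inter> ?B. (d \<omega> \<xi> \<xi>')\<^sup>2"
        have "deviation_sum (\<Xi> \<omega>) (d \<omega>) A ?B c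
          \<le> r * \<eta> * (4 + 2 * C\<^sup>2) * (real (card (\<Xi> \<omega> \<inter> A)) ^ 4 + real (card (\<Xi> \<omega> \<inter> ?B)) ^ 4)
            + 2 * \<eta> / r * ?T + 2 * r / \<eta> ^ 3 * of_bool (\<omega> \<in> G)"
          using elim A zB \<eta> r0 c near by (intro deviation_sum_le finite_points)
        then have "ennreal (deviation_sum (\<Xi> \<omega>) (d \<omega>) A ?B c)
          \<le> ennreal (r * \<eta> * (4 + 2 * C\<^sup>2) * (real (card (\<Xi> \<omega> \<inter> A)) ^ 4 + real (card (\<Xi> \<omega> \<inter> ?B)) ^ 4)
            + (2 * \<eta> / r * ?T + 2 * r / \<eta> ^ 3 * of_bool (\<omega> \<in> G)))"
          by (intro ennreal_leI) (simp add: add.assoc)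
        also have "\<dots> = ?F \<omega>"
        proof -
          have "pair_sum (\<lambda>x. ennreal (x\<^sup>2)) A ?B (realization \<omega>) = ennreal ?T"
            using elim A zB by (simp add: pair_sum_eq sum_nonneg)
          moreover have "0 \<le> ?T" by (intro sum_nonneg) auto
          moreover have "indicator G \<omega> = ennreal (of_bool (\<omega> \<in> G))" by (simp add: indicator_def)
          moreover have "0 \<le> r * \<eta> * (4 + 2 * C\<^sup>2)" "0 \<le> 2 * \<eta> / r" "0 \<le> 2 * r / \<eta> ^ 3"
            using r0 \<eta> by auto
          ultimately show ?thesis
            by (simp only:, intro ennreal_add_mult) auto
        qed
        finally show ?case .
      qed
    qed
    also have "\<dots> = ennreal (r * \<eta> * (4 + 2 * C\<^sup>2)) * ((\<integral>\<^sup>+ \<omega>. ennreal (real (card (\<Xi> \<omega> \<inter> A)) ^ 4) \<partial>M)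
          + (\<integral>\<^sup>+ \<omega>. ennreal (real (card (\<Xi> \<omega> \<inter> ?B)) ^ 4) \<partial>M))
      + (ennreal (2 * \<eta> / r) * (\<integral>\<^sup>+ \<omega>. pair_sum (\<lambda>x. ennreal (x\<^sup>2)) A ?B (realization \<omega>) \<partial>M)
        + ennreal (2 * r / \<eta> ^ 3) * emeasure M G)"
      by (simp add: nn_integral_add nn_integral_cmult)
    also have "\<dots> \<le> ennreal (r * \<eta> * (4 + 2 * C\<^sup>2)) * (ennreal m1 + ennreal m2)
      + (ennreal (2 * \<eta> / r) * ennreal (K * r\<^sup>2) + ennreal (2 * r / \<eta> ^ 3) * ennreal (3 * p))"
      using m1(2)[of 0] m2(2)[of z] K(2)[of z] pG r
      by (intro add_mono mult_left_mono) (auto simp: r_def max_absorb2 emeasure_eq_measure intro!: ennreal_leI)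
    also have "\<dots> = ennreal (r * \<eta> * (4 + 2 * C\<^sup>2) * (m1 + m2) + (2 * \<eta> / r * (K * r\<^sup>2) + 2 * r / \<eta> ^ 3 * (3 * p)))"
    proof -
      have "0 \<le> r * \<eta> * (4 + 2 * C\<^sup>2)" "0 \<le> 2 * \<eta> / r" "0 \<le> 2 * r / \<eta> ^ 3" "0 \<le> 3 * p" "0 \<le> K * r\<^sup>2"
        using r0 \<eta> p K(1) by auto
      then show ?thesis
        using m1(1) m2(1) by (intro ennreal_add_mult[symmetric])
    qed
    also have "r * \<eta> * (4 + 2 * C\<^sup>2) * (m1 + m2) + (2 * \<eta> / r * (K * r\<^sup>2) + 2 * r / \<eta> ^ 3 * (3 * p))
        = r * (\<eta> * \<kappa> + e / 2)"
      using r0 \<eta> by (simp add: \<kappa>_def p_def power2_eq_square field_simps)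
    also have "\<dots> \<le> r * e" using \<eta>\<kappa> r0 by simp
    finally have "(\<integral>\<^sup>+ \<omega>. ennreal (deviation_sum (\<Xi> \<omega>) (d \<omega>) A ?B c) \<partial>M) \<le> ennreal r * ennreal e"
      using r0 e by (simp add: ennreal_leI flip: ennreal_mult)
    then show ?thesis
      using r0 unfolding c_def r_def by (intro divide_le_posI_ennreal) auto
  qed
  then show ?thesis by blast
qed

end

section \<open>From unit vectors to polar angles\<close>

lemma polar_form:
  assumes "z \<noteq> 0"
  shows "z /\<^sub>R norm z = (cos (polar_angle z), sin (polar_angle z))"
proof -
  obtain x y where z: "z = (x, y)" by force
  have "Complex x y = of_real (norm z) * exp (\<i> * of_real (polar_angle z))"
    using Arg2pi_eq[of "Complex x y"] by (simp add: polar_angle_def z norm_Pair complex_norm)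
  then have xy: "x = norm z * cos (polar_angle z)" "y = norm z * sin (polar_angle z)"
    by (simp_all add: complex_eq_iff Re_exp Im_exp)
  have "inverse r *\<^sub>R (r * c, r * s) = (c, s)" if "r \<noteq> 0" for r c s :: real
    using that by simp
  from this[of "norm z" "cos (polar_angle z)" "sin (polar_angle z)"] show ?thesis
    unfolding xy[symmetric] z[symmetric] using assms by simp
qed

text \<open>A chord is no longer than its arc: its length is \<open>2 * \<bar>sin h\<bar>\<close> at
  half angle \<open>h\<close>. Hence the Lipschitz constant of \<open>rate\<close> passes unchanged
  to the angle.\<close>

lemma norm_cos_sin_diff_le: "norm ((cos a, sin a) - (cos b, sin b)) \<le> \<bar>a - b\<bar>" for a b :: real
proof -
  define h where "h = (a - b) / 2"
  have ab: "a - b = 2 * h" by (simp add: h_def)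
  have "(cos a - cos b)\<^sup>2 + (sin a - sin b)\<^sup>2 = 2 - 2 * cos (a - b)"
    using sin_cos_squared_add[of a] sin_cos_squared_add[of b]
    by (simp add: power2_eq_square cos_diff algebra_simps)
  also have "\<dots> = (2 * sin h)\<^sup>2"
    unfolding ab cos_double_sin by (simp add: power_mult_distrib)
  also have "\<dots> \<le> (a - b)\<^sup>2"
    unfolding ab using abs_sin_x_le_abs_x[of h]
    by (intro abs_le_square_iff[THEN iffD1]) (simp add: abs_mult)
  finally have "sqrt ((cos a - cos b)\<^sup>2 + (sin a - sin b)\<^sup>2) \<le> \<bar>a - b\<bar>"
    using real_sqrt_le_mono real_sqrt_abs by metis
  then show ?thesis by (simp add: norm_Pair)
qed

theorem theorem1:
  fixes M :: "'w measure"
    and \<Xi> :: "'w \<Rightarrow> plane set"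
    and d :: "'w \<Rightarrow> plane \<Rightarrow> plane \<Rightarrow> real"
    and law :: "config measure"
  defines "law \<equiv> distr M config_space (\<lambda>\<omega>. (\<Xi> \<omega>, d \<omega>))"
  assumes "prob_space M"
    and "(\<lambda>\<omega>. (\<Xi> \<omega>, d \<omega>)) \<in> measurable M config_space"
    and "unit_poisson_process M \<Xi>"
    and "\<And>\<omega> \<xi> \<xi>'. \<lbrakk>\<omega> \<in> space M; \<xi> \<in> \<Xi> \<omega>; \<xi>' \<in> \<Xi> \<omega>\<rbrakk> \<Longrightarrow> 0 \<le> d \<omega> \<xi> \<xi>'"
    and "\<And>\<omega> \<xi> \<xi>'. \<lbrakk>\<omega> \<in> space M; \<xi> \<in> \<Xi> \<omega>; \<xi>' \<in> \<Xi> \<omega>\<rbrakk> \<Longrightarrow> d \<omega> \<xi> \<xi>' = d \<omega> \<xi>' \<xi>"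
    and "\<And>\<omega> \<xi> \<xi>' \<xi>''. \<lbrakk>\<omega> \<in> space M; \<xi> \<in> \<Xi> \<omega>; \<xi>' \<in> \<Xi> \<omega>; \<xi>'' \<in> \<Xi> \<omega>\<rbrakk>
           \<Longrightarrow> d \<omega> \<xi> \<xi>'' \<le> d \<omega> \<xi> \<xi>' + d \<omega> \<xi>' \<xi>''"
    and "\<And>v. measure_preserving_map law (translate v)"
    and "\<And>v. v \<noteq> 0 \<Longrightarrow> ergodic_map law (translate v)"
    and "\<And>A B. \<lbrakk>A \<in> sets borel; bounded A; B \<in> sets borel; bounded B\<rbrakk> \<Longrightarrow>
           (SUP z. (\<integral>\<^sup>+ \<omega>. ennreal (\<Sum>\<xi> \<in> \<Xi> \<omega> \<inter> A. \<Sum>\<xi>' \<in> \<Xi> \<omega> \<inter> (+) z ` B. (d \<omega> \<xi> \<xi>')\<^sup>2) \<partial>M)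
                    / ennreal (max 1 ((norm z)\<^sup>2))) < \<infinity>"
  shows "\<exists>\<rho> :: real \<Rightarrow> real.
           (\<forall>\<theta> \<in> {0..<2 * pi}. 0 \<le> \<rho> \<theta>) \<and>
           (\<forall>A B. A \<in> sets borel \<and> bounded A \<and> B \<in> sets borel \<and> bounded B \<longrightarrow>
              ((\<lambda>z. (\<integral>\<^sup>+ \<omega>. ennreal (deviation_sum (\<Xi> \<omega>) (d \<omega>) A ((+) z ` B)
                                    (norm z * \<rho> (polar_angle z))) \<partial>M) / ennreal (norm z))
                 \<longlongrightarrow> 0) at_infinity) \<and>
           (SUP (\<theta>\<^sub>1, \<theta>\<^sub>2) \<in> {(s, t). s \<in> {0..<2 * pi} \<and> t \<in> {0..<2 * pi} \<and> s \<noteq> t}.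
              ennreal (\<bar>\<rho> \<theta>\<^sub>2 - \<rho> \<theta>\<^sub>1\<bar> / \<bar>\<theta>\<^sub>2 - \<theta>\<^sub>1\<bar>)) < \<infinity>"
proof -
  interpret P: poisson_metric M \<Xi> d
    by (rule poisson_metric.intro[OF assms(2) poisson_metric_axioms.intro[OF assms(3-10)[unfolded law_def]]])
  define \<rho> where "\<rho> \<theta> = P.rate (cos \<theta>, sin \<theta>)" for \<theta>
  obtain C where C: "C \<ge> 0" "\<And>z. P.\<gamma> z \<le> C * max 1 (norm z)" by (rule P.\<gamma>_bound) blast
  show ?thesis
  proof (intro exI[of _ \<rho>] conjI ballI allI impI)
    show "0 \<le> \<rho> \<theta>" for \<theta> by (simp add: \<rho>_def)
  next
    fix A B :: "plane set"
    assume AB: "A \<in> sets borel \<and> bounded A \<and> B \<in> sets borel \<and> bounded B"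
    show "((\<lambda>z. (\<integral>\<^sup>+ \<omega>. ennreal (deviation_sum (\<Xi> \<omega>) (d \<omega>) A ((+) z ` B)
                                    (norm z * \<rho> (polar_angle z))) \<partial>M) / ennreal (norm z))
                 \<longlongrightarrow> 0) at_infinity"
    proof (rule at_infinity_bound_imp_tendsto_0)
      fix e :: real assume "e > 0"
      then obtain R where R: "\<And>z. norm z \<ge> R \<Longrightarrow>
          (\<integral>\<^sup>+ \<omega>. ennreal (deviation_sum (\<Xi> \<omega>) (d \<omega>) A ((+) z ` B) (norm z * P.rate (z /\<^sub>R norm z))) \<partial>M)
            / ennreal (norm z) \<le> ennreal e"
        using P.deviation_bound[of A B e] AB by blast
      show "\<exists>R. \<forall>z. R \<le> norm z \<longrightarrow>
          (\<integral>\<^sup>+ \<omega>. ennreal (deviation_sum (\<Xi> \<omega>) (d \<omega>) A ((+) z ` B) (norm z * \<rho> (polar_angle z))) \<partial>M)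
            / ennreal (norm z) \<le> ennreal e"
      \<comment> \<open>The 1 keeps \<open>z\<close> away from the origin, which has no
        direction.\<close>
      proof (intro exI[of _ "max R 1"] allI impI)
        fix z :: plane assume z: "max R 1 \<le> norm z"
        then have "z \<noteq> 0" by auto
        then show "(\<integral>\<^sup>+ \<omega>. ennreal (deviation_sum (\<Xi> \<omega>) (d \<omega>) A ((+) z ` B) (norm z * \<rho> (polar_angle z))) \<partial>M)
            / ennreal (norm z) \<le> ennreal e"
          using R[of z] z by (simp add: \<rho>_def polar_form[symmetric])
      qed
    qed
  next
    have "\<bar>\<rho> t - \<rho> s\<bar> / \<bar>t - s\<bar> \<le> C" if "s \<noteq> t" for s t
    proof -
      have "\<bar>\<rho> t - \<rho> s\<bar> \<le> C * norm ((cos t, sin t) - (cos s, sin s))"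
        unfolding \<rho>_def by (rule P.rate_lipschitz[OF C])
      also have "\<dots> \<le> C * \<bar>t - s\<bar>" using C(1) by (intro mult_left_mono norm_cos_sin_diff_le)
      finally show ?thesis using that by (simp add: pos_divide_le_eq)
    qed
    then have "(SUP (\<theta>\<^sub>1, \<theta>\<^sub>2) \<in> {(s, t). s \<in> {0..<2 * pi} \<and> t \<in> {0..<2 * pi} \<and> s \<noteq> t}.
              ennreal (\<bar>\<rho> \<theta>\<^sub>2 - \<rho> \<theta>\<^sub>1\<bar> / \<bar>\<theta>\<^sub>2 - \<theta>\<^sub>1\<bar>)) \<le> ennreal C"
      by (intro SUP_least) (auto intro!: ennreal_leI)
    also have "\<dots> < \<infinity>" by simp
    finally show "(SUP (\<theta>\<^sub>1, \<theta>\<^sub>2) \<in> {(s, t). s \<in> {0..<2 * pi} \<and> t \<in> {0..<2 * pi} \<and> s \<noteq> t}.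
              ennreal (\<bar>\<rho> \<theta>\<^sub>2 - \<rho> \<theta>\<^sub>1\<bar> / \<bar>\<theta>\<^sub>2 - \<theta>\<^sub>1\<bar>)) < \<infinity>" .
  qed
qed

end
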